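(* Let $\Omega\subset\mathbb{O}^2$ be a bounded domain and let $u,v\in OPSH(\Omega)\cap C(\Omega)$. If $\{\mathbf{x}\in\Omega: u(\mathbf{x})<v(\mathbf{x})\}$ is relatively compact in $\Omega$, then $$\int_{\{u<v\}}\det(Hess_{\mathbb{O}}(u))\ \geq\ \int_{\{u<v\}}\det(Hess_{\mathbb{O}}(v)).$$
   Context: $\mathbb{O}$ denotes the octonions: the 8-dimensional real algebra with basis $e_0=1,e_1,\dots,e_7$, $e_p^2=-1$ and $e_pe_q=-e_qe_p$ for $p\neq q$, $p,q\geq1$ (standard Cayley octonions); for $\mathbf{x}=\sum_p x_pe_p$, $\overline{\mathbf{x}}=x_0-\sum_{p\ge1}x_pe_p$. A point of $\mathbb{O}^2$ is $\mathbf{x}=(\mathbf{x}_1,\mathbf{x}_2)$ with $\mathbf{x}_\alpha=\sum_{p=0}^7x_{\alpha p}e_p$, and $\mathbb{O}^2$ is identified with $\mathbb{R}^{16}$. For a function $F$, $\overline{\partial}_\alpha F=\sum_{p=0}^7e_p\frac{\partial F}{\partial x_{\alpha p}}$ and $\partial_\alpha F=\sum_{p=0}^7\frac{\partial F}{\partial x_{\alpha p}}\overline{e}_p$. For a real $C^2$ function $u$, $Hess_{\mathbb{O}}(u)$ is the $2\times2$ octonionic Hermitian matrix with entries $(\overline\partial_\alpha\partial_\beta u)_{\alpha,\beta=1,2}$. For octonionic Hermitian matrices $A=(a_{\alpha\beta}),B=(b_{\alpha\beta})$ (i.e. $a_{11},a_{22}\in\mathbb{R}$, $a_{21}=\overline{a_{12}}$),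 the mixed determinant is $\det(A,B)=\frac12(a_{11}b_{22}+a_{22}b_{11}-2\operatorname{Re}(a_{12}b_{21}))$ and $\det A=\det(A,A)=a_{11}a_{22}-|a_{12}|^2$. An octonionic (right) line in $\mathbb{O}^2$ is $\{(\mathbf{x},\mathbf{a}\mathbf{x}):\mathbf{x}\in\mathbb{O}\}$ for some $\mathbf{a}\in\mathbb{O}$ or $\{(0,\mathbf{x}):\mathbf{x}\in\mathbb{O}\}$; an affine octonionic line is a translate of one. A function $u:\Omega\to[-\infty,\infty)$ on an open set $\Omega\subset\mathbb{O}^2$ is octonionic plurisubharmonic ($u\in OPSH(\Omega)$) if it is upper semicontinuous and its restriction to every affine octonionic line is subharmonic. For $u,v\in OPSH(\Omega)\cap C(\Omega)$, $\det(Hess_{\mathbb{O}}(u),Hess_{\mathbb{O}}(v))$ denotes the mixed octonionic Monge–Ampère measure (Alesker): the unique nonnegative measure on $\Omega$ that equals $\det(Hess_{\mathbb{O}}(u),Hess_{\mathbb{O}}(v))\,dV$ ($dV$ Lebesgue measure) when $u,v\in C^2$, and such that if continuous OPSH $u_n\to u$, $v_n\to v$ locally uniformly then the measures converge weakly. $\det(Hess_{\mathbb{O}}(u)):=\det(Hess_{\mathbb{O}}(u),Hess_{\mathbb{O}}(u))$. *)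

theory Defs
  imports "HOL-Analysis.Analysis"
begin

type_synonym oct = "real ^ 8"
type_synonym pt = "oct \<times> oct"

definition oidx :: "nat \<Rightarrow> 8" where "oidx p = of_nat p"

definition ocoord :: "oct \<Rightarrow> nat \<Rightarrow> real" where "ocoord x p = x $ oidx p"

definition oe :: "nat \<Rightarrow> oct" where "oe p = axis (oidx p) 1"

(* Cayley multiplication table: e_i e_{i+1} = e_{i+3} (indices mod 7 in 1..7) *)
definition fano :: "(nat \<times> nat \<times> nat) list" where
  "fano = [(1,2,4),(2,3,5),(3,4,6),(4,5,7),(5,6,1),(6,7,2),(7,1,3)]"

definition fano_pos :: "nat \<Rightarrow> nat \<Rightarrow> nat \<Rightarrow> bool" where
  "fano_pos p q r \<longleftrightarrow> (\<exists>(a,b,c)\<in>set fano. (p,q,r) = (a,b,c) \<or> (p,q,r) = (b,c,a) \<or> (p,q,r) = (c,a,b))"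

(* coefficient of e_r in e_p e_q *)
definition octc :: "nat \<Rightarrow> nat \<Rightarrow> nat \<Rightarrow> real" where
  "octc p q r =
    (if p = 0 then (if r = q then 1 else 0)
     else if q = 0 then (if r = p then 1 else 0)
     else if p = q then (if r = 0 then -1 else 0)
     else if fano_pos p q r then 1
     else if fano_pos q p r then -1
     else 0)"

definition omul :: "oct \<Rightarrow> oct \<Rightarrow> oct" where
  "omul x y = (\<Sum>p<8. \<Sum>q<8. \<Sum>r<8. (ocoord x p * ocoord y q * octc p q r) *\<^sub>R oe r)"

definition oconj :: "oct \<Rightarrow> oct" where
  "oconj x = ocoord x 0 *\<^sub>R oe 0 - (\<Sum>p\<in>{1..7}. ocoord x p *\<^sub>R oe p)"

definition ore :: "oct \<Rightarrow> real" where "ore x = ocoord x 0"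

definition E :: "nat \<Rightarrow> nat \<Rightarrow> pt" where
  "E \<alpha> p = (if \<alpha> = 1 then (oe p, 0) else (0, oe p))"

definition dd :: "(pt \<Rightarrow> real) \<Rightarrow> pt \<Rightarrow> pt \<Rightarrow> pt \<Rightarrow> real" where
  "dd u h k x = deriv (\<lambda>s. deriv (\<lambda>t. u (x + s *\<^sub>R k + t *\<^sub>R h)) 0) 0"

definition C2_on :: "pt set \<Rightarrow> (pt \<Rightarrow> real) \<Rightarrow> bool" where
  "C2_on U u \<longleftrightarrow> (\<exists>D1 :: pt \<Rightarrow> (pt \<Rightarrow>\<^sub>L real). \<exists>D2 :: pt \<Rightarrow> (pt \<Rightarrow>\<^sub>L (pt \<Rightarrow>\<^sub>L real)).
      (\<forall>x\<in>U. (u has_derivative blinfun_apply (D1 x)) (at x)) \<and>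
      (\<forall>x\<in>U. (D1 has_derivative blinfun_apply (D2 x)) (at x)) \<and>
      continuous_on U D2)"

definition hessO :: "(pt \<Rightarrow> real) \<Rightarrow> pt \<Rightarrow> nat \<Rightarrow> nat \<Rightarrow> oct" where
  "hessO u x \<alpha> \<beta> = (\<Sum>p<8. \<Sum>q<8. dd u (E \<alpha> p) (E \<beta> q) x *\<^sub>R omul (oe p) (oconj (oe q)))"

(* mixed determinant of 2x2 octonionic Hermitian matrices *)
definition odet2 :: "(nat \<Rightarrow> nat \<Rightarrow> oct) \<Rightarrow> (nat \<Rightarrow> nat \<Rightarrow> oct) \<Rightarrow> real" where
  "odet2 A B = (ore (A 1 1) * ore (B 2 2) + ore (A 2 2) * ore (B 1 1)
                 - 2 * ore (omul (A 1 2) (B 2 1))) / 2"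

(* subharmonicity of a continuous real function on an open subset D of O = R^8,
   via the sub-mean-value property on closed balls *)
definition subharmonic_on :: "oct set \<Rightarrow> (oct \<Rightarrow> real) \<Rightarrow> bool" where
  "subharmonic_on D w \<longleftrightarrow>
     (\<forall>c r. 0 < r \<and> cball c r \<subseteq> D \<longrightarrow> w c * measure lborel (cball c r) \<le> integral (cball c r) w)"

(* parametrisations of octonionic right lines *)
definition oline :: "oct option \<Rightarrow> oct \<Rightarrow> pt" where
  "oline a x = (case a of Some a \<Rightarrow> (x, omul a x) | None \<Rightarrow> (0, x))"

definition opsh_cont :: "pt set \<Rightarrow> (pt \<Rightarrow> real) \<Rightarrow> bool" where
  "opsh_cont U u \<longleftrightarrow> continuous_on U u \<and>
     (\<forall>c a. subharmonic_on {x. c + oline a x \<in> U} (\<lambda>x. u (c + oline a x)))"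

section \<open>Mixed octonionic Monge--Ampere measure (Alesker): characterising properties\<close>

definition weak_conv_on :: "pt set \<Rightarrow> (nat \<Rightarrow> pt measure) \<Rightarrow> pt measure \<Rightarrow> bool" where
  "weak_conv_on U \<mu>s \<mu> \<longleftrightarrow>
     (\<forall>\<phi> :: pt \<Rightarrow> real. continuous_on UNIV \<phi> \<and> compact (closure {x. \<phi> x \<noteq> 0}) \<and>
        closure {x. \<phi> x \<noteq> 0} \<subseteq> U \<longrightarrow>
        (\<lambda>n. integral\<^sup>L (\<mu>s n) \<phi>) \<longlonglongrightarrow> integral\<^sup>L \<mu> \<phi>)"

definition locally_uniform_conv :: "pt set \<Rightarrow> (nat \<Rightarrow> pt \<Rightarrow> real) \<Rightarrow> (pt \<Rightarrow> real) \<Rightarrow> bool" where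
  "locally_uniform_conv U fs f \<longleftrightarrow>
     (\<forall>K. compact K \<and> K \<subseteq> U \<longrightarrow> uniform_limit K fs f sequentially)"

definition is_mixed_MA ::
    "(pt set \<Rightarrow> (pt \<Rightarrow> real) \<Rightarrow> (pt \<Rightarrow> real) \<Rightarrow> pt measure) \<Rightarrow> bool" where
  "is_mixed_MA M \<longleftrightarrow>
    (\<forall>U u v. open U \<and> opsh_cont U u \<and> opsh_cont U v \<longrightarrow>
        sets (M U u v) = sets lborel \<and> emeasure (M U u v) (- U) = 0 \<and>
        (\<forall>K. compact K \<and> K \<subseteq> U \<longrightarrow> emeasure (M U u v) K < \<infinity>)) \<and>
    (\<forall>U u v. open U \<and> opsh_cont U u \<and> opsh_cont U v \<and> C2_on U u \<and> C2_on U v \<longrightarrow>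
        M U u v = density lborel (\<lambda>x. ennreal (indicator U x * odet2 (hessO u x) (hessO v x)))) \<and>
    (\<forall>U us vs u v. open U \<and> (\<forall>n. opsh_cont U (us n) \<and> opsh_cont U (vs n)) \<and>
        opsh_cont U u \<and> opsh_cont U v \<and>
        locally_uniform_conv U us u \<and> locally_uniform_conv U vs v \<longrightarrow>
        weak_conv_on U (\<lambda>n. M U (us n) (vs n)) (M U u v)) \<and>
    (\<forall>U W u v. open U \<and> open W \<and> W \<subseteq> U \<and> opsh_cont U u \<and> opsh_cont U v \<longrightarrow>
        (\<forall>A\<in>sets lborel. emeasure (M W u v) A = emeasure (M U u v) (A \<inter> W)))"

end

theory Submission
  imports Defs
begin

text \<open>
  The argument follows Bedford and Taylor. On the open set \<open>G = {u < v}\<close> the function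
  \<open>w = max u (v - \<epsilon>)\<close> is plurisubharmonic, equals \<open>u\<close> off a compact subset of \<open>G\<close>, and tends
  to \<open>v\<close> locally uniformly as \<open>\<epsilon>\<close> tends to 0. Hence the inequality follows from weak convergence once
  the measures of \<open>w\<close> and \<open>u\<close> have the same integral against every cutoff that is 1 near that
  compact set. By weak convergence again it suffices to see this for mollifications, where the
  measures have densities and the difference of the two integrals is the integral of
  \<open>det(Hess f, Hess g)\<close> with \<open>f\<close> of compact support. Integration by parts makes
  the integrals of \<open>(\<partial>\<^sub>a \<partial>\<^sub>b f) (\<partial>\<^sub>c \<partial>\<^sub>d g)\<close> totally symmetric in \<open>a, b, c, d\<close>,
  and then \<open>\<bar>x y\<bar> = \<bar>x\<bar> \<bar>y\<bar>\<close> for octonions makes everything cancel.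
\<close>

section \<open>Octonions\<close>

text \<open>Working on \<open>G\<close> itself, where \<open>u < v\<close> throughout, makes
  \<open>max u (v - \<epsilon>)\<close> plurisubharmonic without any gluing across the boundary. The
  set where it differs from \<open>u\<close> grows to all of \<open>G\<close> as \<epsilon> tends to
  0, so no single cutoff serves every \<epsilon>: a fixed cutoff tests the weak limit, and a larger
  one, chosen anew for each \<epsilon>, carries the comparison with \<open>u\<close>. The functions
  f and g come from factoring a difference of squares, det A - det B = det(A - B, A + B): they are
  mollifications of w - u and w + u. The density in \<open>is_mixed_MA\<close> passes through
  \<open>ennreal\<close>, which cuts negative values to 0. Hence it yields integrals of determinants
  only once the determinants of the mollified Hessians are known to be nonnegative. This is the
  reason for ball moments and Taylor expansion: subharmonicity is given by means over balls and has
  to be turned into nonnegative traces along octonionic lines.\<close>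

lemma lessThan_8: "{..<8::nat} = {0,1,2,3,4,5,6,7}" by auto

lemma oidx_inj: "inj_on oidx {..<8}"
  unfolding inj_on_def lessThan_8 oidx_def by simp

lemma oidx_range: "oidx ` {..<8} = UNIV"
proof -
  have "card (oidx ` {..<8}) = CARD(8)" using card_image[OF oidx_inj] by simp
  then show ?thesis by (metis card_subset_eq finite subset_UNIV)
qed

lemma sum_oidx: "(\<Sum>i\<in>UNIV. f i) = (\<Sum>p<8. f (oidx p))"
  using sum.reindex[OF oidx_inj, of f] oidx_range by simp

lemma oidx_eq_iff: "p < 8 \<Longrightarrow> q < 8 \<Longrightarrow> oidx p = oidx q \<longleftrightarrow> p = q"
  using oidx_inj by (auto simp: inj_on_def)

lemma inner_ocoord: "x \<bullet> y = (\<Sum>p<8. ocoord x p * ocoord y p)"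
  by (simp add: inner_vec_def sum_oidx ocoord_def)

lemma ocoord_oe: "p < 8 \<Longrightarrow> q < 8 \<Longrightarrow> ocoord (oe p) q = (if p = q then 1 else 0)"
  by (auto simp: ocoord_def oe_def axis_def oidx_eq_iff)

lemma ocoord_inner: "ocoord x p = x \<bullet> oe p"
  by (simp add: ocoord_def oe_def inner_axis)

lemma oe_inner_oe: "p < 8 \<Longrightarrow> q < 8 \<Longrightarrow> oe p \<bullet> oe q = (if p = q then 1 else 0)"
  by (metis ocoord_inner ocoord_oe)

lemma oct_eqI: "(\<And>p. p < 8 \<Longrightarrow> ocoord x p = ocoord y p) \<Longrightarrow> x = y"
  by (metis ocoord_def oidx_range image_iff iso_tuple_UNIV_I lessThan_iff vec_eq_iff)

lemma oct_expand: "(\<Sum>p<8. (x \<bullet> oe p) *\<^sub>R oe p) = x"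
  by (rule oct_eqI) (simp add: ocoord_inner inner_sum_left oe_inner_oe if_distrib[where f="\<lambda>x. _ * x"] cong:
      if_cong)

lemma omul_coord: "r < 8 \<Longrightarrow> ocoord (omul x y) r = (\<Sum>p<8. \<Sum>q<8. ocoord x p * ocoord y q * octc p q r)"
  by (simp add: ocoord_inner omul_def inner_sum_left oe_inner_oe if_distrib[where f="\<lambda>x. _ * x"] cong: if_cong)

lemmas oct_table = octc_def fano_pos_def fano_def

lemma omul_coords:
  "ocoord (omul x y) 0 = ocoord x 0 * ocoord y 0 - ocoord x 1 * ocoord y 1 - ocoord x 2 * ocoord y 2 -
      ocoord x 3 * ocoord y 3 - ocoord x 4 * ocoord y 4 - ocoord x 5 * ocoord y 5 - ocoord x 6 * ocoord y 6
      - ocoord x 7 * ocoord y 7"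
  "ocoord (omul x y) 1 = ocoord x 0 * ocoord y 1 + ocoord x 1 * ocoord y 0 + ocoord x 2 * ocoord y 4
      + ocoord x 3 * ocoord y 7 - ocoord x 4 * ocoord y 2
      + ocoord x 5 * ocoord y 6 - ocoord x 6 * ocoord y 5 - ocoord x 7 * ocoord y 3"
  "ocoord (omul x y) 2 = ocoord x 0 * ocoord y 2 - ocoord x 1 * ocoord y 4 + ocoord x 2 * ocoord y 0
      + ocoord x 3 * ocoord y 5 + ocoord x 4 * ocoord y 1 - ocoord x 5 * ocoord y 3
      + ocoord x 6 * ocoord y 7 - ocoord x 7 * ocoord y 6"
  "ocoord (omul x y) 3 = ocoord x 0 * ocoord y 3 - ocoord x 1 * ocoord y 7 - ocoord x 2 * ocoord y 5
      + ocoord x 3 * ocoord y 0 + ocoord x 4 * ocoord y 6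
      + ocoord x 5 * ocoord y 2 - ocoord x 6 * ocoord y 4 + ocoord x 7 * ocoord y 1"
  "ocoord (omul x y) 4 = ocoord x 0 * ocoord y 4
      + ocoord x 1 * ocoord y 2 - ocoord x 2 * ocoord y 1 - ocoord x 3 * ocoord y 6
      + ocoord x 4 * ocoord y 0 + ocoord x 5 * ocoord y 7 + ocoord x 6 * ocoord y 3 - ocoord x 7 * ocoord y 5"
  "ocoord (omul x y) 5 = ocoord x 0 * ocoord y 5 - ocoord x 1 * ocoord y 6
      + ocoord x 2 * ocoord y 3 - ocoord x 3 * ocoord y 2 - ocoord x 4 * ocoord y 7
      + ocoord x 5 * ocoord y 0 + ocoord x 6 * ocoord y 1 + ocoord x 7 * ocoord y 4"
  "ocoord (omul x y) 6 = ocoord x 0 * ocoord y 6 + ocoord x 1 * ocoord y 5 - ocoord x 2 * ocoord y 7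
      + ocoord x 3 * ocoord y 4 - ocoord x 4 * ocoord y 3 - ocoord x 5 * ocoord y 1
      + ocoord x 6 * ocoord y 0 + ocoord x 7 * ocoord y 2"
  "ocoord (omul x y) 7 = ocoord x 0 * ocoord y 7 + ocoord x 1 * ocoord y 3
      + ocoord x 2 * ocoord y 6 - ocoord x 3 * ocoord y 1
      + ocoord x 4 * ocoord y 5 - ocoord x 5 * ocoord y 4 - ocoord x 6 * ocoord y 2 + ocoord x 7 * ocoord y 0"
  by (simp_all add: omul_coord lessThan_8 oct_table)

lemma oconj_coord: "p < 8 \<Longrightarrow> ocoord (oconj x) p = (if p = 0 then ocoord x 0 else - ocoord x p)"
  by (auto simp: ocoord_inner oconj_def inner_diff_left inner_sum_left oe_inner_oe if_distrib[where
      f="\<lambda>x. _ * x"] sum.delta' cong: if_cong)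

lemma inner_coords: "x \<bullet> y = ocoord x 0 * ocoord y 0 + ocoord x 1 * ocoord y 1 + ocoord x 2 * ocoord y 2
    + ocoord x 3 * ocoord y 3
   + ocoord x 4 * ocoord y 4 + ocoord x 5 * ocoord y 5 + ocoord x 6 * ocoord y 6 + ocoord x 7 * ocoord y 7"
  by (simp add: inner_ocoord lessThan_8)

lemma oct_eqI8:
  assumes "ocoord x 0 = ocoord y 0" "ocoord x 1 = ocoord y 1" "ocoord x 2 = ocoord y 2"
      "ocoord x 3 = ocoord y 3"
    "ocoord x 4 = ocoord y 4" "ocoord x 5 = ocoord y 5" "ocoord x 6 = ocoord y 6" "ocoord x 7 = ocoord y 7"
  shows "x = y"
proof (rule oct_eqI)
  fix p :: nat assume "p < 8"
  then have "p \<in> {0,1,2,3,4,5,6,7}" using lessThan_8 by blast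
  then show "ocoord x p = ocoord y p" using assms by auto
qed

text \<open>Degen's eight-square identity: in coordinates it is a polynomial identity in sixteen
  variables, which \<open>algebra\<close> decides.\<close>

lemma omul_norm: "omul x y \<bullet> omul x y = (x \<bullet> x) * (y \<bullet> y)"
  unfolding inner_coords omul_coords by algebra

text \<open>Octonion multiplication is not associative, so factors are never regrouped; they are
  moved across the inner product by this rule and its right-handed twin.\<close>

lemma omul_left_adjoint: "omul a x \<bullet> y = x \<bullet> omul (oconj a) y"
  unfolding inner_coords omul_coords by (simp add: oconj_coord algebra_simps)

lemma omul_right_adjoint: "omul x a \<bullet> y = x \<bullet> omul y (oconj a)"
  unfolding inner_coords omul_coords by (simp add: oconj_coord algebra_simps)

lemma oconj_omul: "oconj (omul x y) = omul (oconj y) (oconj x)"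
  by (rule oct_eqI8; simp only: omul_coords oconj_coord; simp add: oconj_coord omul_coords algebra_simps)

lemma ore_omul: "ore (omul x y) = x \<bullet> oconj y"
  unfolding ore_def inner_coords omul_coords by (simp add: oconj_coord)

lemma oconj_oconj[simp]: "oconj (oconj x) = x"
  by (rule oct_eqI) (simp add: oconj_coord)

lemma oconj_inner: "oconj x \<bullet> oconj y = x \<bullet> y"
  unfolding inner_coords by (simp add: oconj_coord)

lemma omul_bilinear: "bilinear omul"
  unfolding bilinear_def linear_iff
proof safe
  have *: "ocoord (v + w) p = ocoord v p + ocoord w p" "ocoord (c *\<^sub>R v) p = c * ocoord v p" for v w p c
    by (simp_all add: ocoord_def)
  note s = * omul_coord ring_distribs sum.distrib sum_distrib_left mult_ac
  fix x y z c
  show "omul x (y + z) = omul x y + omul x z" by (rule oct_eqI) (simp add: s)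
  show "omul (y + z) x = omul y x + omul z x" by (rule oct_eqI) (simp add: s)
  show "omul x (c *\<^sub>R y) = c *\<^sub>R omul x y" by (rule oct_eqI) (simp add: s)
  show "omul (c *\<^sub>R y) x = c *\<^sub>R omul y x" by (rule oct_eqI) (simp add: s)
qed

text \<open>The norm identity polarised in each factor: expand it at \<open>x + x'\<close> and
  \<open>y + y'\<close> and subtract the lower instances. With \<open>x = x'\<close> it says that
  left multiplication by \<open>x\<close> scales inner products by
  \<open>x \<bullet> x\<close>.\<close>

lemma omul_polar:
  "omul x y \<bullet> omul x' y' + omul x' y \<bullet> omul x y' = 2 * (x \<bullet> x') * (y \<bullet> y')"
proof -
  note lin = bilinear_ladd[OF omul_bilinear] bilinear_radd[OF omul_bilinear] inner_add_left inner_add_right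
  note s = omul_norm[of x y] omul_norm[of x y'] omul_norm[of x' y] omul_norm[of x' y']
    omul_norm[of "x + x'" y] omul_norm[of "x + x'" y'] omul_norm[of x "y + y'"] omul_norm[of x' "y + y'"] 
    omul_norm[of "x + x'" "y + y'"]
  show ?thesis using s unfolding lin by (simp add: inner_commute algebra_simps)
qed

section \<open>The mixed determinant of octonionic Hessians\<close>

text \<open>The octonionic Hessian with second derivatives replaced by an arbitrary form on real
  vectors. The algebra then needs no differentiability and applies to sums and differences of forms
  as well.\<close>

definition hmat :: "(pt \<Rightarrow> pt \<Rightarrow> real) \<Rightarrow> nat \<Rightarrow> nat \<Rightarrow> oct" where
  "hmat B \<alpha> \<beta> = (\<Sum>p<8. \<Sum>q<8. B (E \<alpha> p) (E \<beta> q) *\<^sub>R omul (oe p) (oconj (oe q)))"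

lemma hessO_eq_hmat: "hessO u x = hmat (\<lambda>h k. dd u h k x)"
  by (simp add: hessO_def hmat_def fun_eq_iff)

definition oct_gram :: "nat \<Rightarrow> nat \<Rightarrow> nat \<Rightarrow> nat \<Rightarrow> real" where
  "oct_gram p q p' q' = omul (oe p) (oconj (oe q)) \<bullet> omul (oe p') (oconj (oe q'))"

lemma oconj_linear: "linear oconj"
proof -
  have *: "ocoord (v + w) p = ocoord v p + ocoord w p" "ocoord (c *\<^sub>R v) p = c * ocoord v p" for v w p c
    by (simp_all add: ocoord_def)
  show ?thesis
    unfolding linear_iff by (intro conjI allI; rule oct_eqI) (simp_all add: * oconj_coord)
qed

lemma oct_gram_polar:
  assumes "p < 8" "q < 8" "p' < 8" "q' < 8"
  shows "oct_gram p q p' q' + oct_gram p' q p q' = (if p = p' \<and> q = q' then 2 else 0)"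
  using omul_polar[of "oe p" "oconj (oe q)" "oe p'" "oconj (oe q')"] assms
  by (simp add: oct_gram_def oconj_inner oe_inner_oe split: if_splits)

lemma ore_hmat_diag: "ore (hmat B \<alpha> \<alpha>) = (\<Sum>p<8. B (E \<alpha> p) (E \<alpha> p))"
proof -
  have lin: "linear ore" unfolding ore_def linear_iff by (auto simp: ocoord_def)
  show ?thesis unfolding hmat_def
    by (simp add: linear_sum[OF lin] linear_scale[OF lin] ore_omul oe_inner_oe if_distrib[where
        f="\<lambda>x. _ * x"] cong: if_cong)
qed

lemma oconj_hmat: "oconj (hmat B \<alpha> \<beta>) = hmat (\<lambda>h k. B k h) \<beta> \<alpha>"
  unfolding hmat_def
  by (simp add: linear_sum[OF oconj_linear] linear_scale[OF oconj_linear] oconj_omul) (rule sum.swap)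

lemma hmat_inner:
  "hmat A 1 2 \<bullet> hmat B 1 2 = (\<Sum>p<8. \<Sum>q<8. \<Sum>p'<8. \<Sum>q'<8. A (E 1 p) (E 2 q) * B (E 1 p') (E 2 q') * oct_gram p
      q p' q')"
  unfolding hmat_def oct_gram_def
  by (simp add: inner_sum_left, simp add: inner_sum_right sum_distrib_left mult.assoc)

text \<open>Exhibits the mixed determinant as a fixed linear combination of products of one value of
  \<open>A\<close> and one of \<open>B\<close>. Integrating it therefore involves only integrals of
  products of two second derivatives, the numbers \<open>T\<close> of
  \<open>null_lagrangian\<close>.\<close>

lemma odet2_hmat:
  "odet2 (hmat A) (hmat B) = ((\<Sum>p<8. \<Sum>q<8. A (E 1 p) (E 1 p) * B (E 2 q) (E 2 q)
      + A (E 2 q) (E 2 q) * B (E 1 p) (E 1 p))) / 2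
    - (\<Sum>p<8. \<Sum>q<8. \<Sum>p'<8. \<Sum>q'<8. A (E 1 p) (E 2 q) * B (E 2 q') (E 1 p') * oct_gram p q p' q')"
proof -
  have "ore (omul (hmat A 1 2) (hmat B 2 1)) = hmat A 1 2 \<bullet> hmat (\<lambda>h k. B k h) 1 2"
    by (simp add: ore_omul oconj_hmat)
  also have "\<dots> = (\<Sum>p<8. \<Sum>q<8. \<Sum>p'<8. \<Sum>q'<8. A (E 1 p) (E 2 q) * B (E 2 q') (E 1 p') * oct_gram p q p' q')"
    by (rule hmat_inner)
  finally have 1: "ore (omul (hmat A 1 2) (hmat B 2 1)) = \<dots>" .
  have 2: "(\<Sum>p<8. A (E 2 p) (E 2 p)) * (\<Sum>p<8. B (E 1 p) (E 1 p))
      = (\<Sum>p<8. \<Sum>q<8. A (E 2 q) (E 2 q) * B (E 1 p) (E 1 p))"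
    by (subst sum.swap) (simp add: sum_product)
  show ?thesis
    unfolding odet2_def 1 ore_hmat_diag 2 by (simp add: sum_product sum.distrib diff_divide_distrib
        add_divide_distrib)
qed

text \<open>
  Only the symmetrisation of \<^const>\<open>oct_gram\<close> in \<open>p\<close> and \<open>p'\<close> enters, and by the polarised norm identity
  that symmetrisation is diagonal.
\<close>

lemma null_lagrangian:
  fixes T :: "pt \<Rightarrow> pt \<Rightarrow> pt \<Rightarrow> pt \<Rightarrow> real"
  assumes s12: "\<And>a b c d. T a b c d = T b a c d" and s34: "\<And>a b c d. T a b c d = T a b d c"
    and s23: "\<And>a b c d. T a b c d = T a c b d"
  shows "((\<Sum>p<8. \<Sum>q<8. T (E 1 p) (E 1 p) (E 2 q) (E 2 q) + T (E 2 q) (E 2 q) (E 1 p) (E 1 p))) / 2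
    - (\<Sum>p<8. \<Sum>q<8. \<Sum>p'<8. \<Sum>q'<8. T (E 1 p) (E 2 q) (E 2 q') (E 1 p') * oct_gram p q p' q') = 0"
proof -
  define S where "S = (\<lambda>p q p' q'. T (E 1 p) (E 1 p') (E 2 q) (E 2 q'))"
  have T: "T (E 1 p) (E 2 q) (E 2 q') (E 1 p') = S p q p' q'" for p q p' q'
    unfolding S_def using s12 s34 s23 by metis
  have T2: "T (E 2 q) (E 2 q) (E 1 p) (E 1 p) = S p q p q" for p q
    unfolding S_def using s12 s34 s23 by metis
  have S: "S p q p' q' = S p' q p q'" for p q p' q'
    unfolding S_def by (rule s12)
  define R where "R = (\<Sum>p<8. \<Sum>q<8. \<Sum>p'<8. \<Sum>q'<8. S p q p' q' * oct_gram p q p' q')"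
  \<comment> \<open>Exchange the names \<open>p\<close> and \<open>p'\<close>, under which
    \<open>S\<close> is invariant. The sum swaps that follow restore the order of summation, so that
    adding the result to \<open>R\<close> symmetrises the coefficient.\<close>
  have "R = (\<Sum>p'<8. \<Sum>q<8. \<Sum>p<8. \<Sum>q'<8. S p q p' q' * oct_gram p' q p q')"
    unfolding R_def using S by (intro sum.cong) auto
  also have "\<dots> = (\<Sum>q<8. \<Sum>p'<8. \<Sum>p<8. \<Sum>q'<8. S p q p' q' * oct_gram p' q p q')"
    by (rule sum.swap)
  also have "\<dots> = (\<Sum>q<8. \<Sum>p<8. \<Sum>p'<8. \<Sum>q'<8. S p q p' q' * oct_gram p' q p q')"
    by (rule sum.cong[OF refl], rule sum.swap)
  also have "\<dots> = (\<Sum>p<8. \<Sum>q<8. \<Sum>p'<8. \<Sum>q'<8. S p q p' q' * oct_gram p' q p q')"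
    by (rule sum.swap)
  finally have "2 * R = (\<Sum>p<8. \<Sum>q<8. \<Sum>p'<8. \<Sum>q'<8. S p q p' q' * (oct_gram p q p' q' + oct_gram p' q p q'))"
    unfolding R_def by (simp add: ring_distribs sum.distrib)
  also have "\<dots> = (\<Sum>p<8. \<Sum>q<8. \<Sum>p'<8. \<Sum>q'<8. if q' = q then (if p' = p then 2 * S p q p' q' else 0) else 0)"
    by (intro sum.cong refl) (simp only: oct_gram_polar lessThan_iff, auto)
  also have "\<dots> = (\<Sum>p<8. \<Sum>q<8. 2 * S p q p q)"
    by (intro sum.cong refl) simp
  finally have "R = (\<Sum>p<8. \<Sum>q<8. S p q p q)" by (simp add: sum_distrib_left[symmetric])
  moreover have "(\<Sum>p<8. \<Sum>q<8. T (E 1 p) (E 1 p) (E 2 q) (E 2 q) + T (E 2 q) (E 2 q) (E 1 p) (E 1 p))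
      = 2 * (\<Sum>p<8. \<Sum>q<8. S p q p q)"
    unfolding T2 by (simp add: S_def sum_distrib_left)
  ultimately show ?thesis unfolding T R_def by simp
qed

text \<open>For \<open>h2 > 0\<close> the quadratic in \<open>a\<close> is smallest at
  \<open>a = - H / h2\<close>, where it equals \<open>h1 - (H \<bullet> H) / h2\<close>. For
  \<open>h2 = 0\<close> it is affine in \<open>a\<close> and bounded below, which forces
  \<open>H = 0\<close>.\<close>

lemma quadratic_nonneg_discriminant:
  fixes H :: "'a::real_inner"
  assumes 2: "0 \<le> h2" and Q: "\<And>a. 0 \<le> h1 + 2 * (a \<bullet> H) + (a \<bullet> a) * h2"
  shows "H \<bullet> H \<le> h1 * h2"
proof -
  define n where "n = H \<bullet> H"
  have n: "n \<ge> 0" by (simp add: n_def)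
  have Qt: "0 \<le> h1 - 2 * t * n + t * t * n * h2" for t
    using Q[of "- t *\<^sub>R H"] by (simp add: n_def algebra_simps)
  show ?thesis
  proof (cases "h2 = 0")
    case True
    have "n = 0"
    proof (rule ccontr)
      assume "n \<noteq> 0"
      then have "n > 0" using n by simp
      \<comment> \<open>At this \<open>t\<close> the affine function takes the value
        \<open>-1\<close>.\<close>
      then show False using Qt[of "(h1 + 1) / (2 * n)"] True by simp
    qed
    then show ?thesis using True n_def by simp
  next
    case False
    then have "h2 > 0" using 2 by simp
    then have "0 \<le> h1 - n / h2" using Qt[of "1 / h2"] by (simp add: field_simps)
    then show ?thesis using \<open>h2 > 0\<close> by (simp add: n_def field_simps)
  qed
qed

text \<open>The left-hand side is the Laplacian along the octonionic line \<open>{(x, a x)}\<close>.\<close>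

lemma line_trace:
  assumes B: "bilinear B" and sym: "\<And>h k. B h k = B k h"
  shows "(\<Sum>r<8. B (oline (Some a) (oe r)) (oline (Some a) (oe r)))
    = ore (hmat B 1 1) + 2 * (a \<bullet> hmat B 2 1) + (a \<bullet> a) * ore (hmat B 2 2)"
proof -
  have ex: "(0, omul a (oe r)) = (\<Sum>q<8. (omul a (oe r) \<bullet> oe q) *\<^sub>R E 2 q)" for r
  proof -
    have "(0::oct, omul a (oe r)) = (0, \<Sum>q<8. (omul a (oe r) \<bullet> oe q) *\<^sub>R oe q)" by (simp only: oct_expand)
    also have "\<dots> = (\<Sum>q<8. (0, (omul a (oe r) \<bullet> oe q) *\<^sub>R oe q))" by (simp add: prod_eq_iff fst_sum snd_sum)
    finally show ?thesis by (simp add: E_def)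
  qed
  have l: "linear (B x)" "linear (\<lambda>x. B x y)" for x y using B unfolding bilinear_def by blast+
  have 1: "B (oline (Some a) (oe r)) (oline (Some a) (oe r))
      = B (E 1 r) (E 1 r) + 2 * B (E 1 r) (0, omul a (oe r)) + B (0, omul a (oe r)) (0, omul a (oe r))" for r
  proof -
    have "oline (Some a) (oe r) = E 1 r + (0, omul a (oe r))" by (simp add: oline_def E_def)
    then show ?thesis using sym[of "(0, omul a (oe r))" "E 1 r"]
        by (simp add: bilinear_ladd[OF B] bilinear_radd[OF B])
  qed
  have 2: "(\<Sum>r<8. B (E 1 r) (0, omul a (oe r))) = a \<bullet> hmat B 2 1"
  proof -
    have "(\<Sum>r<8. B (E 1 r) (0, omul a (oe r))) = (\<Sum>r<8. \<Sum>q<8. (omul a (oe r) \<bullet> oe q) * B (E 2 q) (E 1 r))"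
      unfolding ex by (simp add: linear_sum[OF l(1)] linear_scale[OF l(1)]) (intro sum.cong refl, simp add: sym)
    also have "\<dots> = (\<Sum>q<8. \<Sum>r<8. B (E 2 q) (E 1 r) * (a \<bullet> omul (oe q) (oconj (oe r))))"
      by (subst sum.swap) (simp add: omul_right_adjoint mult.commute)
    finally show ?thesis by (simp add: hmat_def inner_sum_right)
  qed
  have 3: "(\<Sum>r<8. B (0, omul a (oe r)) (0, omul a (oe r))) = (a \<bullet> a) * ore (hmat B 2 2)"
  proof -
    \<comment> \<open>Moving \<open>a\<close> across the inner product turns the sum over
      \<open>r\<close> into an expansion in the orthonormal basis, namely the inner product of
      \<open>oe q\<close> and \<open>oe q'\<close> after multiplication by \<open>oconj a\<close>.
      The polarised norm identity evaluates it.\<close>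
    have o: "(\<Sum>r<8. (omul a (oe r) \<bullet> oe q) * (omul a (oe r) \<bullet> oe q')) = (a \<bullet> a) * (oe q \<bullet> oe q')" for q q'
    proof -
      have "(\<Sum>r<8. (omul a (oe r) \<bullet> oe q) * (omul a (oe r) \<bullet> oe q'))
          = omul (oconj a) (oe q) \<bullet> omul (oconj a) (oe q')"
        by (subst inner_ocoord) (simp add: ocoord_inner omul_left_adjoint[of a] inner_commute[of "oe _"
            "omul _ _"])
      then show ?thesis using omul_polar[of "oconj a" "oe q" "oconj a" "oe q'"] by (simp add: oconj_inner)
    qed
    have "(\<Sum>r<8. B (0, omul a (oe r)) (0, omul a (oe r)))
       = (\<Sum>r<8. \<Sum>q<8. \<Sum>q'<8. B (E 2 q) (E 2 q') * ((omul a (oe r) \<bullet> oe q) * (omul a (oe r) \<bullet> oe q')))"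
      unfolding ex by (simp add: linear_sum[OF l(1)] linear_scale[OF l(1)] linear_sum[OF l(2)]
          linear_scale[OF l(2)] sum_distrib_left mult_ac)
        (intro sum.cong refl, simp add: sym)
    also have "\<dots> = (\<Sum>q<8. \<Sum>r<8. \<Sum>q'<8. B (E 2 q) (E 2 q') * ((omul a (oe r) \<bullet> oe q) * (omul a (oe r) \<bullet> oe q')))"
      by (rule sum.swap)
    also have "\<dots> = (\<Sum>q<8. \<Sum>q'<8. \<Sum>r<8. B (E 2 q) (E 2 q') * ((omul a (oe r) \<bullet> oe q) * (omul a (oe r) \<bullet> oe q')))"
      by (rule sum.cong[OF refl], rule sum.swap)
    also have "\<dots> = (\<Sum>q<8. \<Sum>q'<8. B (E 2 q) (E 2 q') * ((a \<bullet> a) * (oe q \<bullet> oe q')))"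
      by (simp add: o sum_distrib_left[symmetric])
    also have "\<dots> = (\<Sum>q<8. \<Sum>q'<8. if q = q' then (a \<bullet> a) * B (E 2 q) (E 2 q) else 0)"
      by (intro sum.cong refl) (simp add: oe_inner_oe)
    also have "\<dots> = (a \<bullet> a) * ore (hmat B 2 2)"
      by (simp add: ore_hmat_diag sum_distrib_left)
    finally show ?thesis .
  qed
  show ?thesis
    using 2 3 unfolding 1 by (simp add: sum.distrib ore_hmat_diag sum_distrib_left[symmetric])
qed

text \<open>By \<open>line_trace\<close> the traces along the lines \<open>Some a\<close> form a
  quadratic polynomial in \<open>a\<close>, whose discriminant condition is exactly the sign of the
  determinant. The line \<open>None\<close> gives the sign of the leading coefficient.\<close>

lemma odet2_hmat_nonneg:
  assumes B: "bilinear B" and sym: "\<And>h k. B h k = B k h"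
    and tr: "\<And>a. 0 \<le> (\<Sum>r<8. B (oline a (oe r)) (oline a (oe r)))"
  shows "0 \<le> odet2 (hmat B) (hmat B)"
proof -
  have 2: "0 \<le> ore (hmat B 2 2)" using tr[of None] by (simp add: oline_def ore_hmat_diag E_def)
  have "hmat B 2 1 \<bullet> hmat B 2 1 \<le> ore (hmat B 1 1) * ore (hmat B 2 2)"
    using tr[of "Some _"] by (intro quadratic_nonneg_discriminant[OF 2]) (simp add: line_trace[OF B sym])
  moreover have "hmat B 1 2 = oconj (hmat B 2 1)" using sym oconj_hmat[of B 2 1] by simp
  ultimately show ?thesis by (simp add: odet2_def ore_omul oconj_inner)
qed

section \<open>Moments of balls and Taylor expansion\<close>

text \<open>Tested on boxes: the preimage of a box is its image under the inverse map, which is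
  orthogonal too, and orthogonal images keep Lebesgue measure.\<close>

lemma lborel_distr_orthogonal:
  fixes T :: "real^'n::{finite,wellorder} \<Rightarrow> real^'n::_"
  assumes T: "orthogonal_transformation T"
  shows "distr lborel borel T = lborel"
proof (rule sym, rule lborel_eqI)
  have lin: "linear T" using T by (rule orthogonal_transformation_linear)
  then have meas[measurable]: "T \<in> borel \<rightarrow>\<^sub>M borel"
    by (intro borel_measurable_continuous_onI linear_continuous_on) (simp add: linear_conv_bounded_linear)
  fix l u :: "real^'n::_" assume "\<And>b. b \<in> Basis \<Longrightarrow> l \<bullet> b \<le> u \<bullet> b"
  then have m: "measure lborel (box l u) = (\<Prod>b\<in>Basis. (u - l) \<bullet> b)"
    by (simp add: measure_lborel_box_eq)
  define S where "S = T -` box l u"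
  obtain T' where T': "orthogonal_transformation T'" "T' = inv T" using orthogonal_transformation_inv[OF T]
      by blast
  have S: "S = T' ` box l u"
    unfolding S_def T'(2) using bij_vimage_eq_inv_image[OF orthogonal_transformation_bij[OF T]] by blast
  have Sb: "S \<in> sets borel" unfolding S_def using measurable_sets[OF meas, of "box l u"] by simp
  have "measure lborel S = measure lborel (box l u)"
    using measure_orthogonal_image[OF T'(1) lmeasurable_box, of l u] unfolding S[symmetric]
    using Sb by (simp add: measure_completion)
  moreover have "emeasure lborel S \<noteq> \<infinity>"
    using measurable_orthogonal_image[OF T'(1) lmeasurable_box, of l u] unfolding S[symmetric]
    using Sb by (auto simp: fmeasurable_def)
  ultimately have "emeasure lborel S = ennreal (\<Prod>b\<in>Basis. (u - l) \<bullet> b)"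
    using m by (simp add: emeasure_eq_ennreal_measure top.not_eq_extremum)
  then show "emeasure (distr lborel borel T) (box l u) = ennreal (\<Prod>b\<in>Basis. (u - l) \<bullet> b)"
    by (simp add: emeasure_distr S_def)
qed simp

lemma integral_orthogonal_ball:
  fixes T :: "real^'n::{finite,wellorder} \<Rightarrow> real^'n::_" and f :: "real^'n::_ \<Rightarrow> real"
  assumes T: "orthogonal_transformation T" and f: "continuous_on UNIV f"
  shows "integral\<^sup>L lborel (\<lambda>x. indicator (cball 0 r) x * f (T x))
      = integral\<^sup>L lborel (\<lambda>x. indicator (cball 0 r) x * f x)"
proof -
  have lin: "linear T" using T by (rule orthogonal_transformation_linear)
  then have meas[measurable]: "T \<in> borel \<rightarrow>\<^sub>M borel"
    by (intro borel_measurable_continuous_onI linear_continuous_on) (simp add: linear_conv_bounded_linear)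
  have [measurable]: "f \<in> borel_measurable borel" using f by (rule borel_measurable_continuous_onI)
  have i: "indicator (cball 0 r) (T x) = (indicator (cball 0 r) x :: real)" for x
    using orthogonal_transformation_norm[OF T, of x] by (simp add: indicator_def)
  have "integral\<^sup>L lborel (\<lambda>x. indicator (cball 0 r) x * f x)
      = integral\<^sup>L (distr lborel borel T) (\<lambda>x. indicator (cball 0 r) x * f x)"
    by (simp add: lborel_distr_orthogonal[OF T])
  also have "\<dots> = integral\<^sup>L lborel (\<lambda>x. indicator (cball 0 r) x * f (T x))"
    by (subst integral_distr) (auto simp: i intro!: borel_measurable_times borel_measurable_indicator)
  finally show ?thesis by simp
qed

lemma integrable_ball:
  fixes f :: "'a::euclidean_space \<Rightarrow> real"
  assumes "continuous_on UNIV f" shows "integrable lborel (\<lambda>x. indicator (cball c r) x * f x)"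
  using borel_integrable_compact[of "cball c r" f] assms continuous_on_subset by auto

text \<open>Removes the gradient term when a Taylor expansion is averaged over a ball: the integrand
  changes sign under reflection in the centre.\<close>

lemma ball_odd_moment:
  fixes f :: "real^'n::{finite,wellorder} \<Rightarrow> real"
  assumes f: "linear f"
  shows "integral\<^sup>L lborel (\<lambda>x. indicator (cball 0 r) x * f x) = 0"
proof -
  have c: "continuous_on UNIV f" using f by (intro linear_continuous_on) (simp add: linear_conv_bounded_linear)
  have "orthogonal_transformation (uminus :: real^'n::_ \<Rightarrow> _)"
    by (simp add: orthogonal_transformation_neg orthogonal_transformation_id)
  from integral_orthogonal_ball[OF this c, of r] show ?thesis by (simp add: linear_neg[OF f])
qed

lemma swap_coordinates_orthogonal:
  fixes i j :: "'n::finite"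
  shows "orthogonal_transformation (\<lambda>x::real^'n. \<chi> k. x $ (Transposition.transpose i j k))"
  unfolding orthogonal_transformation_def
proof (intro conjI allI)
  show "linear (\<lambda>x::real^'n. \<chi> k. x $ (Transposition.transpose i j k))"
    by (auto simp: linear_iff vec_eq_iff)
  show "(\<chi> k. v $ Transposition.transpose i j k) \<bullet> (\<chi> k. w $ Transposition.transpose i j k) = v \<bullet> w" for v w
      :: "real^'n"
    unfolding inner_vec_def
    using sum.permute[of "Transposition.transpose i j" UNIV "\<lambda>k. v $ k * w $ k"]
    by (simp add: o_def permutes_swap_id)
qed

lemma flip_coordinate_orthogonal:
  fixes i :: "'n::finite"
  shows "orthogonal_transformation (\<lambda>x::real^'n. \<chi> k. if k = i then - (x $ k) else x $ k)"
  unfolding orthogonal_transformation_def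
proof (intro conjI allI)
  show "linear (\<lambda>x::real^'n. \<chi> k. if k = i then - (x $ k) else x $ k)"
    by (auto simp: linear_iff vec_eq_iff)
  show "(\<chi> k. if k = i then - (v $ k) else v $ k) \<bullet> (\<chi> k. if k = i then - (w $ k) else w $ k) = v \<bullet> w" for v
      w :: "real^'n"
    unfolding inner_vec_def by (intro sum.cong) auto
qed

text \<open>Coordinate flips annihilate the mixed moments, coordinate swaps make the others equal.\<close>

lemma ball_second_moment:
  fixes i j :: "'n::{finite,wellorder}"
  shows "integral\<^sup>L lborel (\<lambda>x. indicator (cball 0 r) x * (x $ i * x $ j))
    = (if i = j then integral\<^sup>L lborel (\<lambda>x::real^'n::_. indicator (cball 0 r) x * (x \<bullet> x)) / CARD('n) else 0)"
proof -
  define m where "m = (\<lambda>i j. integral\<^sup>L lborel (\<lambda>x::real^'n::_. indicator (cball 0 r) x * (x $ i * x $ j)))"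
  have c: "continuous_on UNIV (\<lambda>x::real^'n::_. x $ k * x $ l)" for k l by (intro continuous_intros)
  have off: "m i j = 0" if "i \<noteq> j" for i j
  proof -
    have "m i j = - m i j"
      using integral_orthogonal_ball[OF flip_coordinate_orthogonal[of i] c[of i j], of r] that
      by (simp add: m_def)
    then show ?thesis by simp
  qed
  have diag: "m k k = m i i" for k
    using integral_orthogonal_ball[OF swap_coordinates_orthogonal[of i k] c[of i i], of r] by (simp add: m_def)
  have "integral\<^sup>L lborel (\<lambda>x::real^'n::_. indicator (cball 0 r) x * (x \<bullet> x)) = (\<Sum>k\<in>UNIV. m k k)"
    unfolding m_def inner_vec_def sum_distrib_left
        by (subst Bochner_Integration.integral_sum) (auto intro!: integrable_ball c)
  also have "\<dots> = (\<Sum>k\<in>(UNIV :: 'n set). m i i)" by (intro sum.cong refl diag)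
  also have "\<dots> = CARD('n) * m i i" by simp
  finally show ?thesis using off unfolding m_def by auto
qed

text \<open>Since the mixed moments vanish, only the trace of \<open>Q\<close> survives; averaging a
  second-order expansion over a ball thus detects the Laplacian.\<close>

lemma ball_quadratic_moment:
  fixes Q :: "real^'n::{finite,wellorder} \<Rightarrow> real^'n::_ \<Rightarrow> real"
  assumes Q: "bilinear Q"
  shows "integral\<^sup>L lborel (\<lambda>x. indicator (cball 0 r) x * Q x x)
    = (\<Sum>k\<in>UNIV. Q (axis k 1) (axis k 1)) * (integral\<^sup>L lborel (\<lambda>x::real^'n::_. indicator (cball 0 r) x * (x
        \<bullet> x)) / CARD('n))"
proof -
  have l: "linear (Q x)" "linear (\<lambda>x. Q x y)" for x y using Q unfolding bilinear_def by blast+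
  have c: "continuous_on UNIV (\<lambda>x::real^'n::_. x $ k * x $ l)" for k l by (intro continuous_intros)
  have ex: "x = (\<Sum>k\<in>UNIV. x $ k *\<^sub>R axis k 1)" for x :: "real^'n::_"
    by (metis (no_types, lifting) basis_expansion scalar_mult_eq_scaleR sum.cong)
  have "indicator (cball 0 r) x * Q x x = (\<Sum>k\<in>UNIV. \<Sum>l\<in>UNIV. Q (axis k 1) (axis l 1) * (indicator (cball 0
      r) x * (x $ k * x $ l)))" for x :: "real^'n::_"
  proof -
    have "Q x x = Q (\<Sum>k\<in>UNIV. x $ k *\<^sub>R axis k 1) (\<Sum>k\<in>UNIV. x $ k *\<^sub>R axis k 1)" using ex[of x] by simp
    also have "\<dots> = (\<Sum>k\<in>UNIV. \<Sum>l\<in>UNIV. x $ k * (x $ l * Q (axis k 1) (axis l 1)))"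
      by (simp add: linear_sum[OF l(1)] linear_scale[OF l(1)] linear_sum[OF l(2)] linear_scale[OF l(2)]
          sum_distrib_left)
         (subst sum.swap, simp add: mult.left_commute)
    finally show ?thesis by (simp add: sum_distrib_left mult_ac)
  qed
  then have "integral\<^sup>L lborel (\<lambda>x. indicator (cball 0 r) x * Q x x)
     = (\<Sum>k\<in>UNIV. \<Sum>l\<in>UNIV. Q (axis k 1) (axis l 1) * integral\<^sup>L lborel (\<lambda>x. indicator (cball 0 r) x * (x $ k
         * x $ l)))"
    by (simp add: Bochner_Integration.integral_sum integrable_ball c)
  also have "\<dots> = (\<Sum>k\<in>UNIV. Q (axis k 1) (axis k 1) * (integral\<^sup>L lborel (\<lambda>x::real^'n::_. indicator (cball 0
      r) x * (x \<bullet> x)) / CARD('n)))"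
    unfolding ball_second_moment by (simp add: if_distrib[where f="\<lambda>x. _ * x"] cong: if_cong)
  finally show ?thesis by (simp add: sum_distrib_right sum_divide_distrib)
qed

lemma ball_square_moment_pos:
  fixes r :: real assumes "r > 0"
  shows "0 < integral\<^sup>L lborel (\<lambda>x::'a::euclidean_space. indicator (cball 0 r) x * (x \<bullet> x))"
proof -
  have "integral\<^sup>L lborel (\<lambda>x::'a. indicator (cball 0 r) x * (x \<bullet> x)) \<noteq> 0"
  proof
    assume "integral\<^sup>L lborel (\<lambda>x::'a. indicator (cball 0 r) x * (x \<bullet> x)) = 0"
    then have "AE x::'a in lborel. indicator (cball 0 r) x * (x \<bullet> x) = 0"
      by (subst (asm) integral_nonneg_eq_0_iff_AE) (auto intro!: integrable_ball continuous_intros)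
    moreover have "AE x::'a in lborel. x \<noteq> 0" by (rule AE_lborel_singleton)
    ultimately have "AE x::'a in lborel. x \<notin> cball 0 r"
      by eventually_elim (auto simp: indicator_def split: if_splits)
    then have "emeasure lborel (cball (0::'a) r) = 0"
      by (subst (asm) AE_iff_measurable[OF _ refl]) (auto simp: cball_def)
    then show False using content_cball_pos[OF assms, of "0::'a"] by (simp add: measure_def)
  qed
  then show ?thesis by (simp add: order_less_le Bochner_Integration.integral_nonneg)
qed

lemma second_order_taylor:
  fixes u :: "'a::real_normed_vector \<Rightarrow> real"
  assumes U: "open U" "x \<in> U" and D1: "\<And>y. y \<in> U \<Longrightarrow> (u has_derivative blinfun_apply (D1 y)) (at y)"
    and D2: "(D1 has_derivative blinfun_apply D2) (at x)" and e: "e > 0"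
  obtains d where "d > 0" "\<And>h. norm h \<le> d \<Longrightarrow> \<bar>u (x + h) - u x - D1 x h - D2 h h / 2\<bar> \<le> e * (norm h)\<^sup>2"
proof -
  obtain d0 where d0: "d0 > 0" "ball x d0 \<subseteq> U" using U openE by blast
  obtain d1 where d1: "d1 > 0" "\<And>y. norm (y - x) < d1 \<Longrightarrow> norm (D1 y - D1 x - D2 (y - x)) \<le> e * norm (y - x)"
    using D2 e unfolding has_derivative_at_alt by blast
  define d where "d = min d0 d1 / 2"
  have "d > 0" using d0 d1 by (simp add: d_def)
  moreover have "\<bar>u (x + h) - u x - D1 x h - D2 h h / 2\<bar> \<le> e * (norm h)\<^sup>2" if h: "norm h \<le> d" for h
  proof -
    \<comment> \<open>The Taylor remainder along the segment, up to the constant \<open>u x\<close>.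
      Its derivative is the error of the linear approximation of \<open>D1\<close> at
      \<open>x\<close>, applied to \<open>h\<close>, so the mean value inequality gives the
      quadratic bound.\<close>
    define g where "g = (\<lambda>t. u (x + t *\<^sub>R h) - t * D1 x h - t\<^sup>2 / 2 * D2 h h)"
    have small: "norm (t *\<^sub>R h) < d0" "norm (t *\<^sub>R h) < d1" "norm (t *\<^sub>R h) \<le> norm h" if "t \<in> {0..1}" for t
    proof -
      have "norm (t *\<^sub>R h) \<le> norm h" using that by (simp add: mult_left_le_one_le)
      moreover have "d < d0" "d < d1" using d0 d1 by (auto simp: d_def min_def)
      ultimately show "norm (t *\<^sub>R h) < d0" "norm (t *\<^sub>R h) < d1" "norm (t *\<^sub>R h) \<le> norm h" using h by linarith+
    qed
    have g': "(g has_derivative (\<lambda>s. s * (D1 (x + t *\<^sub>R h) h - D1 x h - t * D2 h h))) (at t within {0..1})"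
        if t: "t \<in> {0..1}" for t
    proof -
      have "x + t *\<^sub>R h \<in> U" using small[OF t] d0 by (auto simp: dist_norm)
      have *: "((\<lambda>t. u (x + t *\<^sub>R h)) has_derivative (\<lambda>s. D1 (x + t *\<^sub>R h) (s *\<^sub>R h))) (at t within {0..1})"
        by (rule has_derivative_compose[where g = u and f = "\<lambda>t. x + t *\<^sub>R h", OF _ D1[OF \<open>x + t *\<^sub>R h \<in> U\<close>]])
           (auto intro!: derivative_eq_intros)
      show ?thesis unfolding g_def
        by (rule derivative_eq_intros * | simp)+ (auto
            simp: blinfun.scaleR_right fun_eq_iff algebra_simps power2_eq_square)
    qed
    have B: "onorm (\<lambda>s. s * (D1 (x + t *\<^sub>R h) h - D1 x h - t * D2 h h)) \<le> e * (norm h)\<^sup>2"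
        if t: "t \<in> {0..1}" for t
    proof (rule onorm_le)
      fix s :: real
      have "\<bar>D1 (x + t *\<^sub>R h) h - D1 x h - t * D2 h h\<bar> = \<bar>(D1 (x + t *\<^sub>R h) - D1 x - D2 (t *\<^sub>R h)) h\<bar>"
        by (simp add: blinfun.diff_left blinfun.scaleR_right blinfun.scaleR_left)
      also have "\<dots> \<le> norm (D1 (x + t *\<^sub>R h) - D1 x - D2 (t *\<^sub>R h)) * norm h"
        using norm_blinfun[of "D1 (x + t *\<^sub>R h) - D1 x - D2 (t *\<^sub>R h)" h] by simp
      also have "\<dots> \<le> (e * norm (t *\<^sub>R h)) * norm h"
        using d1(2)[of "x + t *\<^sub>R h"] small[OF t] by (intro mult_right_mono) auto
      also have "\<dots> \<le> (e * norm h) * norm h"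
        using small[OF t] e by (intro mult_right_mono mult_left_mono) auto
      finally have "\<bar>D1 (x + t *\<^sub>R h) h - D1 x h - t * D2 h h\<bar> \<le> e * (norm h)\<^sup>2"
        by (simp add: power2_eq_square algebra_simps)
      from mult_right_mono[OF this, of "norm s"]
      show "norm (s * (D1 (x + t *\<^sub>R h) h - D1 x h - t * D2 h h)) \<le> e * (norm h)\<^sup>2 * norm s"
        by (simp add: abs_mult mult.commute)
    qed
    have "norm (g 1 - g 0) \<le> e * (norm h)\<^sup>2 * norm (1 - 0 :: real)"
      by (rule differentiable_bound[OF _ g' B]) auto
    then show ?thesis by (simp add: g_def algebra_simps)
  qed
  ultimately show ?thesis using that by blast
qed

section \<open>Plurisubharmonic functions of class \<open>C\<^sup>2\<close>\<close>

text \<open>The outer variable \<open>s\<close> moves along \<open>k\<close>, so \<open>k\<close> is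
  the direction in which \<open>D1\<close> is differentiated and comes first in \<open>D2\<close>.
  The inner derivative is known only at points of \<open>U\<close>, which is enough because
  \<open>deriv\<close> depends only on values near 0.\<close>

lemma dd_eq_second_derivative:
  assumes U: "open U" "x \<in> U" and D1: "\<And>y. y \<in> U \<Longrightarrow> (u has_derivative blinfun_apply (D1 y)) (at y)"
    and D2: "(D1 has_derivative blinfun_apply D2) (at x)"
  shows "dd u h k x = D2 k h"
proof -
  have der: "deriv (\<lambda>t. u (y + t *\<^sub>R h)) 0 = D1 y h" if "y \<in> U" for y
  proof (rule DERIV_imp_deriv)
    have "((\<lambda>t. u (y + t *\<^sub>R h)) has_derivative (\<lambda>t. D1 y (t *\<^sub>R h))) (at 0)"
      by (rule has_derivative_compose[where g = u and f = "\<lambda>t. y + t *\<^sub>R h"])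
         (auto intro!: derivative_eq_intros D1 that)
    then show "DERIV (\<lambda>t. u (y + t *\<^sub>R h)) 0 :> D1 y h"
      by (simp add: has_field_derivative_def blinfun.scaleR_right mult.commute[of _ "D1 y h"])
  qed
  have "continuous (at 0) (\<lambda>s. x + s *\<^sub>R k)" for s :: real by (intro continuous_intros)
  then have "eventually (\<lambda>s. x + s *\<^sub>R k \<in> U) (at (0::real))"
    using U by (auto simp: continuous_at dest!: topological_tendstoD[where S = U])
  then have "eventually (\<lambda>s. deriv (\<lambda>t. u (x + s *\<^sub>R k + t *\<^sub>R h)) 0 = D1 (x + s *\<^sub>R k) h) (nhds (0::real))"
    using U by (auto simp: eventually_at_filter der elim!: eventually_mono)
  then have "dd u h k x = deriv (\<lambda>s. D1 (x + s *\<^sub>R k) h) 0"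
    unfolding dd_def by (rule deriv_cong_ev) simp
  also have "\<dots> = D2 k h"
  proof (rule DERIV_imp_deriv)
    have "((\<lambda>s. D1 (x + s *\<^sub>R k)) has_derivative (\<lambda>s. D2 (s *\<^sub>R k))) (at 0)"
      by (rule has_derivative_compose[where g = D1 and f = "\<lambda>t. x + t *\<^sub>R k"])
         (auto intro!: derivative_eq_intros D2)
    then have "((\<lambda>s. D1 (x + s *\<^sub>R k) h) has_derivative (\<lambda>s. D2 (s *\<^sub>R k) h)) (at 0)"
      by (rule bounded_linear.has_derivative[OF blinfun.bounded_linear_left])
    then show "DERIV (\<lambda>s. D1 (x + s *\<^sub>R k) h) 0 :> D2 k h"
      by (simp add: has_field_derivative_def blinfun.scaleR_right blinfun.scaleR_left)
         (metis (no_types, lifting) ext has_derivative_eq_rhs mult.commute)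
  qed
  finally show ?thesis .
qed

lemma oline_linear: "linear (oline a)"
  unfolding linear_iff oline_def
  by (auto split: option.splits simp: bilinear_radd[OF omul_bilinear] bilinear_rmul[OF omul_bilinear])

text \<open>Compare the value at \<open>x\<close> with the mean over a small ball in the line
  through \<open>x\<close>. In the averaged Taylor expansion the constants cancel, the linear term
  integrates to 0, and the quadratic term is a positive multiple of the trace.\<close>

lemma opsh_trace_nonneg:
  assumes U: "open U" "x \<in> U" and D1: "\<And>y. y \<in> U \<Longrightarrow> (u has_derivative blinfun_apply (D1 y)) (at y)"
    and D2: "(D1 has_derivative blinfun_apply D2) (at x)" and psh: "opsh_cont U u"
  shows "0 \<le> (\<Sum>r<8. D2 (oline a (oe r)) (oline a (oe r)))"
proof -
  define L where "L = oline a"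
  have linL: "linear L" unfolding L_def by (rule oline_linear)
  then have bL: "bounded_linear L" by (simp add: linear_conv_bounded_linear)
  then obtain C where C: "C > 0" "\<And>y. norm (L y) \<le> norm y * C" using bounded_linear.pos_bounded by blast
  have contL: "continuous_on A L" for A using bL by (rule linear_continuous_on)
  define S where "S = (\<Sum>r<8. D2 (L (oe r)) (L (oe r)))"
  \<comment> \<open>16 is 2 times 8: one half from Taylor's formula, one eighth from the mean of a
    quadratic form in dimension 8. \<open>C\<close> bounds the parametrisation and expresses the
    Taylor error in the variable of the ball.\<close>
  have "S \<ge> - (16 * C\<^sup>2 * e)" if e: "e > 0" for e
  proof -
    obtain d where d: "d > 0" "\<And>h. norm h \<le> d \<Longrightarrow> \<bar>u (x + h) - u x - D1 x h - D2 h h / 2\<bar> \<le> e * (norm h)\<^sup>2"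
      using second_order_taylor[OF U D1 D2 e] by blast
    obtain d' where d': "d' > 0" "cball x d' \<subseteq> U" using U open_contains_cball by blast
    define r where "r = min d d' / C"
    have r: "r > 0" "r * C \<le> d" "r * C \<le> d'" using d d' C by (auto simp: r_def)
    have small: "norm (L y) \<le> d" "norm (L y) \<le> d'" if "y \<in> cball 0 r" for y
    proof -
      have "norm y * C \<le> r * C" using that C by (intro mult_right_mono) auto
      then show "norm (L y) \<le> d" "norm (L y) \<le> d'" using C(2)[of y] r by linarith+
    qed
    have inU: "x + L y \<in> U" if "y \<in> cball 0 r" for y
      using small[OF that] d' by (auto simp: dist_norm)
    define m where "m = integral\<^sup>L lborel (\<lambda>y::oct. indicator (cball 0 r) y * (y \<bullet> y))"
    have m: "m > 0" unfolding m_def using r by (intro ball_square_moment_pos)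
    \<comment> \<open>The upper Taylor bound of \<open>u\<close> along the line; it is a polynomial
      in \<open>y\<close>, so its integral over the ball reduces to moments.\<close>
    define g where "g = (\<lambda>y. u x + D1 x (L y) + D2 (L y) (L y) / 2 + e * C\<^sup>2 * (y \<bullet> y))"
    have contg: "continuous_on A g" for A unfolding g_def by (intro continuous_intros contL) auto
    have wint: "(\<lambda>y. u (x + L y)) integrable_on cball 0 r"
    proof (rule set_borel_integral_eq_integral(1))
      have "continuous_on (cball 0 r) (\<lambda>y. u (x + L y))"
        using psh inU unfolding opsh_cont_def
        by (intro continuous_on_compose2[of U u "cball 0 r" "\<lambda>y. x + L y"] continuous_intros contL) auto
      then show "set_integrable lborel (cball 0 r) (\<lambda>y. u (x + L y))"
        unfolding set_integrable_def by (intro borel_integrable_compact) auto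
    qed
    have gset: "set_integrable lborel (cball 0 r) g"
      unfolding set_integrable_def by (intro borel_integrable_compact contg) auto
    have "u (x + L 0) * measure lborel (cball (0::oct) r) \<le> integral (cball 0 r) (\<lambda>y. u (x + L y))"
    proof -
      have "subharmonic_on {y. x + L y \<in> U} (\<lambda>y. u (x + L y))"
        using psh unfolding opsh_cont_def L_def by blast
      moreover have "cball 0 r \<subseteq> {y. x + L y \<in> U}" using inU by auto
      ultimately show ?thesis using r(1) unfolding subharmonic_on_def by blast
    qed
    also have "\<dots> \<le> integral (cball 0 r) g"
    proof (rule integral_le[OF wint set_borel_integral_eq_integral(1)[OF gset]])
      fix y :: oct assume y: "y \<in> cball 0 r"
      have "(norm (L y))\<^sup>2 \<le> (norm y * C)\<^sup>2" using C(2) by (intro power_mono) auto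
      then have "e * (norm (L y))\<^sup>2 \<le> e * (C\<^sup>2 * (y \<bullet> y))"
        using e by (intro mult_left_mono) (auto simp: power_mult_distrib power2_norm_eq_inner mult.commute)
      then show "u (x + L y) \<le> g y" using d(2)[OF small(1)[OF y]] unfolding g_def
          by (simp add: abs_if split: if_splits)
    qed
    also have "\<dots> = integral\<^sup>L lborel (\<lambda>y. indicator (cball 0 r) y * g y)"
      using set_borel_integral_eq_integral(2)[OF gset] by (simp add: set_lebesgue_integral_def)
    also have "\<dots> = u x * measure lborel (cball (0::oct) r) + S * m / 16 + e * C\<^sup>2 * m"
    proof -
      have Q: "bilinear (\<lambda>y z. D2 (L y) (L z))"
        unfolding bilinear_def
        by (auto intro!: linearI simp: linear_add[OF linL] linear_scale[OF linL] blinfun.add_left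
            blinfun.add_right blinfun.scaleR_left blinfun.scaleR_right)
      have l1: "linear (\<lambda>y. D1 x (L y))"
        by (auto intro!: linearI simp: linear_add[OF linL] linear_scale[OF linL] blinfun.add_right
            blinfun.scaleR_right)
      have S: "S = (\<Sum>k\<in>UNIV. D2 (L (axis k 1)) (L (axis k 1)))"
        by (simp add: S_def sum_oidx oe_def)
      have c1: "continuous_on UNIV (\<lambda>y. D1 x (L y))" "continuous_on UNIV (\<lambda>y. D2 (L y) (L y))"
          "continuous_on UNIV (\<lambda>y::oct. y \<bullet> y)" "continuous_on UNIV (\<lambda>y::oct. u x)"
        by (intro continuous_intros contL)+
      note i = integrable_ball[OF c1(1), of 0 r] integrable_ball[OF c1(2), of 0 r] integrable_ball[OF c1(3),
          of 0 r]  integrable_ball[OF c1(4), of 0 r]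
      have "integral\<^sup>L lborel (\<lambda>y. indicator (cball 0 r) y * g y)
        = integral\<^sup>L lborel (\<lambda>y. indicator (cball 0 r) y * u x + indicator (cball 0 r) y * D1 x (L y)
           + (indicator (cball 0 r) y * D2 (L y) (L y)) / 2 + (e * C\<^sup>2) * (indicator (cball 0 r) y * (y \<bullet> y)))"
        by (rule Bochner_Integration.integral_cong) (auto simp: g_def algebra_simps)
      also have "\<dots> = measure lborel (cball (0::oct) r) * u x + 0 + S * m / 16 + (e * C\<^sup>2) * m"
        using i ball_odd_moment[OF l1, of r] ball_quadratic_moment[OF Q, of r]
        by (simp add: S m_def[symmetric] card_bit0)
      finally show ?thesis by (simp add: mult.commute)
    qed
    finally have "0 \<le> m * (S / 16 + e * C\<^sup>2)" using linear_0[OF linL] by (simp add: algebra_simps)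
    then have "0 \<le> S / 16 + e * C\<^sup>2" using m by (simp add: zero_le_mult_iff)
    then show ?thesis by (simp add: algebra_simps)
  qed
  then have "0 \<le> S + e" if "e > 0" for e
    using C(1) that divide_pos_pos[of e "16 * C\<^sup>2"] by (fastforce simp: field_simps)
  then have "0 \<le> S" by (rule field_le_epsilon)
  then show ?thesis by (simp add: S_def L_def)
qed

text \<open>Symmetry of the second derivative enters as a hypothesis because for mollifications it
  can be read off from the kernel.\<close>

lemma odet2_hessO_nonneg:
  assumes U: "open U" "x \<in> U" and D1: "\<And>y. y \<in> U \<Longrightarrow> (u has_derivative blinfun_apply (D1 y)) (at y)"
    and D2: "(D1 has_derivative blinfun_apply D2) (at x)" and psh: "opsh_cont U u"
    and sym: "\<And>h k. D2 h k = D2 k h"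
  shows "0 \<le> odet2 (hessO u x) (hessO u x)"
proof -
  have "bilinear (\<lambda>h k. D2 k h)"
    unfolding bilinear_def
    by (intro conjI allI linearI) (simp_all add: blinfun.add_left blinfun.add_right blinfun.scaleR_left
        blinfun.scaleR_right)
  moreover have "0 \<le> (\<Sum>r<8. D2 (oline a (oe r)) (oline a (oe r)))" for a
    by (rule opsh_trace_nonneg[OF U D1 D2 psh])
  ultimately have "0 \<le> odet2 (hmat (\<lambda>h k. D2 k h)) (hmat (\<lambda>h k. D2 k h))"
    using sym by (intro odet2_hmat_nonneg) auto
  moreover have "dd u h k x = D2 k h" for h k
    by (rule dd_eq_second_derivative[OF U D1 D2])
  ultimately show ?thesis by (simp add: hessO_eq_hmat)
qed

section \<open>Convolution and integration by parts\<close>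

definition Cc :: "('a::euclidean_space \<Rightarrow> real) \<Rightarrow> bool" where
  "Cc f \<longleftrightarrow> continuous_on UNIV f \<and> (\<exists>R. \<forall>x. norm x > R \<longrightarrow> f x = 0)"

lemma ccI: "continuous_on UNIV f \<Longrightarrow> (\<And>x. norm x > R \<Longrightarrow> f x = 0) \<Longrightarrow> Cc f"
  unfolding Cc_def by blast

lemma Cc_continuous: "Cc f \<Longrightarrow> continuous_on A f"
  unfolding Cc_def using continuous_on_subset by blast

lemma Cc_bound: assumes "Cc f" obtains R where "R > 0" "\<And>x. norm x > R \<Longrightarrow> f x = 0"
proof -
  obtain R where "\<And>x. norm x > R \<Longrightarrow> f x = 0" using assms Cc_def by blast
  then show ?thesis by (intro that[of "max R 1"]) auto
qed

lemma Cc_integrable: assumes "Cc f" shows "integrable lborel f"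
proof -
  obtain R where R: "\<And>x. norm x > R \<Longrightarrow> f x = 0" using Cc_bound[OF assms] by blast
  have "integrable lborel (\<lambda>x. indicator (cball 0 R) x * f x)"
    using assms by (intro integrable_ball Cc_continuous)
  also have "(\<lambda>x. indicator (cball 0 R) x * f x) = f"
    using R by (fastforce simp: indicator_def)
  finally show ?thesis .
qed

lemma Cc_mult_right: "Cc f \<Longrightarrow> continuous_on UNIV g \<Longrightarrow> Cc (\<lambda>x. f x * g x)"
  unfolding Cc_def by (auto intro!: continuous_intros)

lemma Cc_mult_left: "Cc f \<Longrightarrow> continuous_on UNIV g \<Longrightarrow> Cc (\<lambda>x. g x * f x)"
  unfolding Cc_def by (auto intro!: continuous_intros)

lemma Cc_cmult: "Cc f \<Longrightarrow> Cc (\<lambda>x. c * f x)"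
  by (rule Cc_mult_left) auto

lemma Cc_add: assumes "Cc f" "Cc g" shows "Cc (\<lambda>x. f x + g x)"
proof -
  obtain R where R: "\<And>x. norm x > R \<Longrightarrow> f x = 0" using Cc_bound[OF assms(1)] by blast
  obtain S where S: "\<And>x. norm x > S \<Longrightarrow> g x = 0" using Cc_bound[OF assms(2)] by blast
  show ?thesis by (rule ccI[of _ "max R S"]) (auto
      intro!: continuous_on_add Cc_continuous[OF assms(1)] Cc_continuous[OF assms(2)] simp: R S)
qed

lemma Cc_diff: assumes "Cc f" "Cc g" shows "Cc (\<lambda>x. f x - g x)"
  using Cc_add[OF assms(1) Cc_cmult[OF assms(2), of "-1"]] by simp

lemma Cc_uniformly_continuous: assumes "Cc (f :: 'a::euclidean_space \<Rightarrow> real)" "e > 0"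
  obtains d where "d > 0" "\<And>x y. dist x y < d \<Longrightarrow> \<bar>f x - f y\<bar> < e"
proof -
  obtain R where R: "R > 0" "\<And>x. norm x > R \<Longrightarrow> f x = 0" using Cc_bound[OF assms(1)] by blast
  have "uniformly_continuous_on (cball 0 (R+1)) f"
    by (intro compact_uniformly_continuous Cc_continuous assms) auto
  then obtain d where d: "d > 0" "\<And>x y. x \<in> cball 0 (R+1) \<Longrightarrow> y \<in> cball 0 (R+1) \<Longrightarrow> dist y x < d
      \<Longrightarrow> dist (f y) (f x) < e"
    using assms(2) unfolding uniformly_continuous_on_def by metis
  show ?thesis
  proof (rule that[of "min d 1"])
    show "min d 1 > 0" using d by auto
    fix x y :: 'a assume xy: "dist x y < min d 1"
    show "\<bar>f x - f y\<bar> < e"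
    proof (cases "norm x \<le> R + 1 \<and> norm y \<le> R + 1")
      case True then show ?thesis using d(2)[of y x] xy by (auto simp: dist_real_def)
    next
      case False
      have "\<bar>norm x - norm y\<bar> < 1" using xy norm_triangle_ineq3[of x y] by (auto simp: dist_norm)
      then have "norm x > R" "norm y > R" using False by auto
      then show ?thesis using R assms by simp
    qed
  qed
qed

lemma Cc_shift: assumes "Cc (f :: 'a::euclidean_space \<Rightarrow> real)" shows "Cc (\<lambda>y. f (x - y))"
proof -
  obtain R where R: "\<And>x. norm x > R \<Longrightarrow> f x = 0" using Cc_bound[OF assms] by blast
  show ?thesis
  proof (rule ccI[of _ "R + norm x"])
    show "continuous_on UNIV (\<lambda>y. f (x - y))"
      by (rule continuous_on_compose2[OF Cc_continuous[OF assms, of UNIV]]) (auto intro!: continuous_intros)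
    fix y :: 'a assume "norm y > R + norm x"
    then show "f (x - y) = 0" using R norm_triangle_ineq2[of y x] by (simp add: norm_minus_commute)
  qed
qed

lemma lborel_reflect:
  fixes f :: "'a::euclidean_space \<Rightarrow> real"
  assumes "continuous_on UNIV f"
  shows "integral\<^sup>L lborel (\<lambda>y. f (x - y)) = integral\<^sup>L lborel f"
proof -
  have [measurable]: "f \<in> borel_measurable borel" using assms by (rule borel_measurable_continuous_onI)
  have "integral\<^sup>L lborel f = integral\<^sup>L (distr lborel borel (\<lambda>y. x + (-1) *\<^sub>R y)) f"
    using lborel_affine[of "-1" x] by (simp add: density_1)
  also have "\<dots> = integral\<^sup>L lborel (\<lambda>y. f (x - y))"
    by (subst integral_distr) auto
  finally show ?thesis by simp
qed

lemma lborel_integral_cbox: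
  fixes f :: "'a::euclidean_space \<Rightarrow> real"
  assumes "integrable lborel f" "\<And>x. x \<notin> cbox a b \<Longrightarrow> f x = 0"
  shows "integral\<^sup>L lborel f = integral (cbox a b) f"
proof -
  have "(\<lambda>x. if x \<in> cbox a b then f x else 0) = f" using assms(2) by auto
  then show ?thesis using integral_lborel[OF assms(1)] integral_restrict_UNIV[of "cbox a b" f] by simp
qed

text \<open>The two arguments have different roles: \<open>h\<close> brings the compact support that
  makes the integral exist, and \<open>k\<close> takes the derivatives.\<close>

definition conv :: "('a::euclidean_space \<Rightarrow> real) \<Rightarrow> ('a \<Rightarrow> real) \<Rightarrow> 'a \<Rightarrow> real" where
  "conv h k x = integral\<^sup>L lborel (\<lambda>y. h y * k (x - y))"

lemma conv_integrand_Cc: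
  assumes "Cc h" "continuous_on UNIV k" shows "Cc (\<lambda>y. h y * k (x - y))"
  by (intro Cc_mult_right assms continuous_on_compose2[OF assms(2)]) (auto intro!: continuous_intros)

text \<open>One box serves all \<open>k\<close> and \<open>x\<close>, so theorems on parameter
  integrals over a fixed box apply to \<open>k\<close> as well as to its derivatives.\<close>

lemma conv_cbox:
  assumes h: "Cc (h :: 'a::euclidean_space \<Rightarrow> real)"
  obtains a b where "\<And>k x. continuous_on UNIV k \<Longrightarrow> conv h k x = integral (cbox a b) (\<lambda>y. h y * k (x - y))"
proof -
  obtain R where R: "\<And>x. norm x > R \<Longrightarrow> h x = 0" using Cc_bound[OF h] by blast
  obtain a where a: "cball (0::'a) R \<subseteq> cbox (-a) a" using bounded_subset_cbox_symmetric[OF bounded_cball]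
      by metis
  show ?thesis
  proof (rule that[of "-a" a])
    fix k x assume k: "continuous_on UNIV (k :: 'a \<Rightarrow> real)"
    show "conv h k x = integral (cbox (-a) a) (\<lambda>y. h y * k (x - y))"
      unfolding conv_def
    proof (rule lborel_integral_cbox)
      show "integrable lborel (\<lambda>y. h y * k (x - y))"
        by (rule Cc_integrable[OF conv_integrand_Cc[OF h k]])
      fix y assume "y \<notin> cbox (-a) a"
      then have "norm y > R" using a by (auto simp: subset_eq)
      then show "h y * k (x - y) = 0" using R by simp
    qed
  qed
qed

lemma conv_continuous:
  assumes h: "Cc h" and k: "continuous_on UNIV k"
  shows "continuous_on A (conv h k)"
proof -
  obtain a b where ab: "\<And>x. conv h k x = integral (cbox a b) (\<lambda>y. h y * k (x - y))" using conv_cbox[OF h] k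
      by metis
  have "continuous_on A (\<lambda>x. integral (cbox a b) (\<lambda>y. h y * k (x - y)))"
    by (rule integral_continuous_on_param)
       (auto simp: split_def intro!: continuous_intros continuous_on_compose2[OF k]
           continuous_on_compose2[OF Cc_continuous[OF h, of UNIV]])
  then show ?thesis by (simp add: ab[abs_def])
qed

lemma conv_has_derivative:
  fixes h k :: "'a::euclidean_space \<Rightarrow> real"
  assumes h: "Cc h" and k: "\<And>z. (k has_derivative (\<lambda>v. k1 v z)) (at z)" and k1: "\<And>v. continuous_on UNIV (k1 v)"
  shows "(conv h k has_derivative (\<lambda>v. conv h (k1 v) x)) (at x)"
proof -
  have contk: "continuous_on UNIV k"
    by (rule has_derivative_continuous_on) (use k in auto)
  obtain a b where ab: "\<And>k x. continuous_on UNIV k \<Longrightarrow> conv h k x = integral (cbox a b) (\<lambda>y. h y * k (x - y))"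
    using conv_cbox[OF h] by metis
  \<comment> \<open>The derivative of the integrand as a bounded linear map. Expanding it over
    \<open>Basis\<close> reduces the joint continuity demanded by \<open>leibniz_rule\<close> to
    that of finitely many directional derivatives.\<close>
  define fx where "fx = (\<lambda>x y. h y *\<^sub>R (\<Sum>i\<in>Basis. k1 i (x - y) *\<^sub>R blinfun_inner_left i))"
  have fx: "blinfun_apply (fx x y) v = h y * k1 v (x - y)" for x y v
  proof -
    have lin: "linear (\<lambda>v. k1 v (x - y))" using has_derivative_linear[OF k] .
    have "k1 v (x - y) = k1 (\<Sum>i\<in>Basis. (v \<bullet> i) *\<^sub>R i) (x - y)" by (simp add: euclidean_representation)
    also have "\<dots> = (\<Sum>i\<in>Basis. (v \<bullet> i) * k1 i (x - y))"
      by (simp only: linear_sum[OF lin] linear_scale[OF lin] real_scaleR_def)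
    finally show ?thesis
      by (simp add: fx_def blinfun.scaleR_left blinfun.sum_left mult.commute)
  qed
  have "((\<lambda>x. integral (cbox a b) (\<lambda>y. h y * k (x - y))) has_derivative integral (cbox a b) (fx x)) (at x
      within UNIV)"
  proof (rule leibniz_rule)
    fix x t
    have "((\<lambda>x. k (x - t)) has_derivative (\<lambda>v. k1 v (x - t))) (at x)"
      by (rule has_derivative_compose[where g = k and f = "\<lambda>x. x - t"]) (auto intro!: derivative_eq_intros k)
    then show "((\<lambda>x. h t * k (x - t)) has_derivative blinfun_apply (fx x t)) (at x within UNIV)"
      unfolding fx by (rule has_derivative_mult_right)
  next
    fix x show "(\<lambda>y. h y * k (x - y)) integrable_on cbox a b"
      by (intro integrable_continuous Cc_continuous[OF conv_integrand_Cc[OF h contk]])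
  next
    show "continuous_on (UNIV \<times> cbox a b) (\<lambda>(x, y). fx x y)"
      unfolding fx_def split_def
      by (intro continuous_intros continuous_on_compose2[OF k1] continuous_on_compose2[OF Cc_continuous[OF
          h, of UNIV]]) auto
  qed auto
  moreover have "blinfun_apply (integral (cbox a b) (fx x)) = (\<lambda>v. conv h (k1 v) x)"
  proof -
    have "fx x integrable_on cbox a b"
      unfolding fx_def
      by (intro integrable_continuous continuous_intros continuous_on_compose2[OF k1] Cc_continuous[OF h]) auto
    then show ?thesis by (simp add: blinfun_apply_integral fx ab[OF k1] fun_eq_iff)
  qed
  moreover have "conv h k = (\<lambda>x. integral (cbox a b) (\<lambda>y. h y * k (x - y)))"
    using ab[OF contk] by auto
  ultimately show ?thesis by simp
qed

lemma conv_zero: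
  assumes "\<And>y. h y \<noteq> 0 \<Longrightarrow> k (x - y) = 0" shows "conv h k x = 0"
  unfolding conv_def using assms by (intro integral_eq_zero_AE AE_I2) auto

lemma conv_Cc:
  assumes h: "Cc h" and k: "Cc k" shows "Cc (conv h k)"
proof -
  obtain R where R: "\<And>x. norm x > R \<Longrightarrow> h x = 0" using Cc_bound[OF h] by blast
  obtain S where S: "\<And>x. norm x > S \<Longrightarrow> k x = 0" using Cc_bound[OF k] by blast
  show ?thesis
  proof (rule ccI[of _ "R + S"])
    show "continuous_on UNIV (conv h k)" by (intro conv_continuous h Cc_continuous k)
    fix x :: 'a assume x: "norm x > R + S"
    show "conv h k x = 0"
    proof (rule conv_zero)
      fix y assume "h y \<noteq> 0"
      then have "norm y \<le> R" using R not_less by blast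
      then have "norm (x - y) > S" using x norm_triangle_ineq2[of x y] by linarith
      then show "k (x - y) = 0" by (rule S)
    qed
  qed
qed

lemma deriv_Cc:
  assumes f: "Cc f" and f1: "\<And>z. (f has_derivative (\<lambda>v. f1 v z)) (at z)" and c: "continuous_on UNIV (f1 v)"
  shows "Cc (f1 v)"
proof -
  obtain R where R: "\<And>x. norm x > R \<Longrightarrow> f x = 0" using Cc_bound[OF f] by blast
  show ?thesis
  proof (rule ccI[OF c, of R])
    fix x :: 'a assume x: "norm x > R"
    have "open {x::'a. norm x > R}" by (intro open_Collect_less continuous_intros)
    then have "(f has_derivative (\<lambda>v. 0)) (at x)"
      by (rule has_derivative_transform_within_open[OF has_derivative_const[of 0]]) (use x R in auto)
    then show "f1 v x = 0" using has_derivative_unique[OF f1] by metis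
  qed
qed

text \<open>
  Convolution of \<open>f\<close> with a cutoff that is 1 on a large ball is constant near the origin;
  differentiate it there.
\<close>

lemma integral_deriv_zero:
  fixes f :: "'a::euclidean_space \<Rightarrow> real"
  assumes f: "Cc f" and f1: "\<And>z. (f has_derivative (\<lambda>v. f1 v z)) (at z)" and c: "\<And>v. continuous_on UNIV (f1 v)"
  shows "integral\<^sup>L lborel (f1 v) = 0"
proof -
  have cc1: "Cc (f1 v)" by (rule deriv_Cc[OF f f1 c])
  obtain R where R: "R > 0" "\<And>x. norm x > R \<Longrightarrow> f x = 0" using Cc_bound[OF f] by blast
  obtain S where S: "S > 0" "\<And>x. norm x > S \<Longrightarrow> f1 v x = 0" using Cc_bound[OF cc1] by blast
  \<comment> \<open>Equal to 1 up to radius \<open>R + S + 1\<close>. If \<open>x\<close> is in the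
    unit ball and \<open>f (x - y)\<close> is nonzero, then \<open>norm y\<close> is at most
    \<open>R + 1\<close>; the summand \<open>S\<close> takes care of the support of
    \<open>f1 v\<close>.\<close>
  define h where "h = (\<lambda>y::'a. max 0 (min 1 (R + S + 2 - norm y)))"
  have h: "Cc h" by (rule ccI[of _ "R + S + 2"]) (auto simp: h_def intro!: continuous_intros)
  have h1: "h y = 1" if "norm y \<le> R + S + 1" for y using that by (simp add: h_def)
  have const: "conv h f x = integral\<^sup>L lborel f" if x: "x \<in> ball 0 1" for x
  proof -
    have "h y * f (x - y) = f (x - y)" for y
    proof (cases "f (x - y) = 0")
      case False
      then have "norm (x - y) \<le> R" using R not_less by blast
      then have "norm y \<le> R + 1" using x norm_triangle_ineq2[of y x] by (simp add: norm_minus_commute)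
      then show ?thesis using h1[of y] S by simp
    qed simp
    then show ?thesis unfolding conv_def by (simp only: lborel_reflect[OF Cc_continuous[OF f, of UNIV],
        where x = x])
  qed
  have "(conv h f has_derivative (\<lambda>v. 0)) (at 0)"
    by (rule has_derivative_transform_within_open[OF has_derivative_const[of
        "integral\<^sup>L lborel f"], where s = "ball 0 1"])
       (auto intro: const[symmetric])
  then have "conv h (f1 v) 0 = 0"
    using has_derivative_unique[OF conv_has_derivative[OF h f1 c, of 0]] by metis
  moreover have "conv h (f1 v) 0 = integral\<^sup>L lborel (f1 v)"
  proof -
    have "h y * f1 v (0 - y) = f1 v (0 - y)" for y
    proof (cases "f1 v (0 - y) = 0")
      case False
      then have "norm (0 - y) \<le> S" using S not_less by blast
      then show ?thesis using h1[of y] R by simp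
    qed simp
    then show ?thesis unfolding conv_def by (simp only: lborel_reflect[OF c, where x = 0])
  qed
  ultimately show ?thesis by simp
qed

text \<open>The product of \<open>f\<close> and \<open>g\<close> has bounded support because
  \<open>f\<close> has, so its derivative integrates to 0.\<close>

lemma integration_by_parts_Cc:
  fixes f g :: "'a::euclidean_space \<Rightarrow> real"
  assumes f: "Cc f" and f1: "\<And>z. (f has_derivative (\<lambda>v. f1 v z)) (at z)" and c: "\<And>v. continuous_on UNIV (f1 v)"
    and g1: "\<And>z. (g has_derivative (\<lambda>v. g1 v z)) (at z)" and d: "\<And>v. continuous_on UNIV (g1 v)"
  shows "integral\<^sup>L lborel (\<lambda>x. f x * g1 v x) = - integral\<^sup>L lborel (\<lambda>x. f1 v x * g x)"
proof -
  have contg: "continuous_on UNIV g" by (rule has_derivative_continuous_on) (use g1 in auto)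
  have "integral\<^sup>L lborel (\<lambda>x. f x * g1 v x + f1 v x * g x) = 0"
  proof (rule integral_deriv_zero[where ?f1.0 = "\<lambda>v x. f x * g1 v x + f1 v x * g x"])
    show "Cc (\<lambda>x. f x * g x)" by (rule Cc_mult_right[OF f contg])
    show "((\<lambda>x. f x * g x) has_derivative (\<lambda>v. f z * g1 v z + f1 v z * g z)) (at z)" for z
      using has_derivative_mult[OF f1 g1] .
    show "continuous_on UNIV (\<lambda>x. f x * g1 v x + f1 v x * g x)" for v
      by (intro continuous_intros Cc_continuous[OF f] c d contg)
  qed
  moreover have "integrable lborel (\<lambda>x. f x * g1 v x)" "integrable lborel (\<lambda>x. f1 v x * g x)"
    by (intro Cc_integrable Cc_mult_right f d deriv_Cc[OF f f1 c] contg)+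
  ultimately show ?thesis by simp
qed

section \<open>Mollification kernels\<close>

lemma max_power_deriv:
  assumes "k \<ge> 1"
  shows "((\<lambda>t::real. max 0 t ^ Suc k) has_field_derivative (real (Suc k) * max 0 t ^ k)) (at t)"
proof -
  consider "t < 0" | "t > 0" | "t = 0" by linarith
  then show ?thesis
  proof cases
    case 1
    have "((\<lambda>t::real. 0) has_field_derivative 0) (at t)" by simp
    then have "((\<lambda>t::real. max 0 t ^ Suc k) has_field_derivative 0) (at t)"
      by (rule has_field_derivative_transform_within_open[where S = "{..<0}"]) (use 1 in auto)
    then show ?thesis using 1 assms by (simp add: power_0_left)
  next
    case 2
    have "((\<lambda>t::real. t ^ Suc k) has_field_derivative (real (Suc k) * t ^ k)) (at t)"
      by (rule derivative_eq_intros refl | simp)+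
    then have "((\<lambda>t::real. max 0 t ^ Suc k) has_field_derivative (real (Suc k) * t ^ k)) (at t)"
      by (rule has_field_derivative_transform_within_open[where S = "{0<..}"]) (use 2 in auto)
    then show ?thesis using 2 by simp
  next
    case 3
    have "((\<lambda>h::real. max 0 h ^ Suc k / h) \<longlongrightarrow> 0) (at 0)"
    proof (rule Lim_null_comparison)
      show "eventually (\<lambda>h::real. norm (max 0 h ^ Suc k / h) \<le> \<bar>h\<bar> ^ k) (at 0)"
        by (rule always_eventually) (auto simp: max_def abs_mult power_abs)
      have "((\<lambda>h::real. \<bar>h\<bar> ^ k) \<longlongrightarrow> \<bar>0\<bar> ^ k) (at 0)" by (intro tendsto_intros)
      then show "((\<lambda>h::real. \<bar>h\<bar> ^ k) \<longlongrightarrow> 0) (at 0)" using assms by (simp add: power_0_left)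
    qed
    then show ?thesis using 3 assms by (simp add: DERIV_def power_0_left)
  qed
qed

text \<open>A truncated power rather than an exponential: finite smoothness is enough here, and the
  derivatives are polynomials times lower truncated powers, hence available in closed form.\<close>

definition bump :: "real \<Rightarrow> nat \<Rightarrow> 'a::real_inner \<Rightarrow> real" where
  "bump \<delta> k x = max 0 (\<delta>\<^sup>2 - x \<bullet> x) ^ k"

lemma bump_has_derivative:
  assumes "k \<ge> 1"
  shows "(bump \<delta> (Suc k) has_derivative (\<lambda>v. - 2 * real (Suc k) * (x \<bullet> v) * bump \<delta> k x)) (at x)"
proof -
  have "((\<lambda>x. \<delta>\<^sup>2 - x \<bullet> x) has_derivative (\<lambda>v. - 2 * (x \<bullet> v))) (at x)"
    by (auto intro!: derivative_eq_intros simp: inner_commute)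
  from has_derivative_compose[OF this max_power_deriv[OF assms, unfolded has_field_derivative_def]]
  have "(bump \<delta> (Suc k) has_derivative (\<lambda>v. - 2 * (x \<bullet> v) * (real (Suc k) * bump \<delta> k x))) (at x)"
    by (simp only: bump_def[abs_def] mult.commute)
  then show ?thesis by (rule has_derivative_eq_rhs) (simp add: fun_eq_iff algebra_simps)
qed

lemma bump_continuous[continuous_intros]: "continuous_on A (bump \<delta> k)"
  unfolding bump_def by (intro continuous_intros)

lemma bump_nonneg: "0 \<le> bump \<delta> k x" by (simp add: bump_def)

lemma bump_zero: "k \<ge> 1 \<Longrightarrow> norm x \<ge> \<bar>\<delta>\<bar> \<Longrightarrow> bump \<delta> k x = 0"
  using power2_le_iff_abs_le[of "norm x" \<delta>] by (auto
      simp: bump_def power2_norm_eq_inner[symmetric] max_def abs_le_square_iff)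

text \<open>
  The exponent 4 is the smallest for which the third derivatives, needed for the two integrations
  by parts below, are continuous; the other kernels are the successive directional derivatives.
\<close>

definition ker0 :: "real \<Rightarrow> real \<Rightarrow> 'a::euclidean_space \<Rightarrow> real" where
  "ker0 c \<delta> x = c * bump \<delta> 4 x"
definition ker1 :: "real \<Rightarrow> real \<Rightarrow> 'a::euclidean_space \<Rightarrow> 'a \<Rightarrow> real" where
  "ker1 c \<delta> a x = c * (- 8 * (x \<bullet> a) * bump \<delta> 3 x)"
definition ker2 :: "real \<Rightarrow> real \<Rightarrow> 'a::euclidean_space \<Rightarrow> 'a \<Rightarrow> 'a \<Rightarrow> real" where
  "ker2 c \<delta> a b x = c * (48 * (x \<bullet> a) * (x \<bullet> b) * bump \<delta> 2 x - 8 * (a \<bullet> b) * bump \<delta> 3 x)"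
definition ker3 :: "real \<Rightarrow> real \<Rightarrow> 'a::euclidean_space \<Rightarrow> 'a \<Rightarrow> 'a \<Rightarrow> 'a \<Rightarrow> real" where
  "ker3 c \<delta> a b d x = c * (48 * ((a \<bullet> b) * (x \<bullet> d) + (a \<bullet> d) * (x \<bullet> b) + (b \<bullet> d) * (x \<bullet> a)) * bump \<delta> 2 x
     - 192 * (x \<bullet> a) * (x \<bullet> b) * (x \<bullet> d) * bump \<delta> 1 x)"

lemma ker0_has_derivative: "(ker0 c \<delta> has_derivative (\<lambda>v. ker1 c \<delta> v x)) (at x)"
  unfolding ker0_def[abs_def] ker1_def
  using bump_has_derivative[of 3 \<delta> x] by (auto intro!: derivative_eq_intros)

lemma ker1_has_derivative: "(ker1 c \<delta> a has_derivative (\<lambda>v. ker2 c \<delta> a v x)) (at x)"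
proof -
  have b: "(bump \<delta> 3 has_derivative (\<lambda>v. - 6 * (x \<bullet> v) * bump \<delta> 2 x)) (at x)"
    using bump_has_derivative[of 2 \<delta> x] by simp
  show ?thesis unfolding ker1_def[abs_def] ker2_def
    by (rule derivative_eq_intros b refl | simp)+ (simp add: fun_eq_iff algebra_simps inner_commute)
qed

lemma ker2_has_derivative: "(ker2 c \<delta> a b has_derivative (\<lambda>v. ker3 c \<delta> a b v x)) (at x)"
proof -
  have b3: "(bump \<delta> 3 has_derivative (\<lambda>v. - 6 * (x \<bullet> v) * bump \<delta> 2 x)) (at x)"
    using bump_has_derivative[of 2 \<delta> x] by simp
  have b2: "(bump \<delta> 2 has_derivative (\<lambda>v. - 4 * (x \<bullet> v) * bump \<delta> 1 x)) (at x)"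
    using bump_has_derivative[of 1 \<delta> x] by (simp add: numeral_2_eq_2)
  show ?thesis unfolding ker2_def[abs_def] ker3_def
    by (rule derivative_eq_intros b2 b3 refl | simp)+ (simp add: fun_eq_iff algebra_simps inner_commute)
qed

text \<open>Together with \<open>ker3_sym\<close> this takes the place of the theorem on equality of
  mixed partial derivatives: derivatives of a mollification fall on the kernel, where the symmetry
  is visible.\<close>

lemma ker2_sym: "ker2 c \<delta> a b = ker2 c \<delta> b a"
  by (simp add: ker2_def[abs_def] inner_commute mult_ac)

lemma ker3_sym: "ker3 c \<delta> a b d = ker3 c \<delta> a d b"
  by (simp add: ker3_def[abs_def] inner_commute algebra_simps)

lemma ker_zero:
  assumes "norm x \<ge> \<bar>\<delta>\<bar>"
  shows "ker0 c \<delta> x = 0" "ker1 c \<delta> a x = 0" "ker2 c \<delta> a b x = 0" "ker3 c \<delta> a b d x = 0"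
  using assms by (auto simp: ker0_def ker1_def ker2_def ker3_def bump_zero)

lemma ker_Cc: "Cc (ker0 c \<delta>)" "Cc (ker1 c \<delta> a)" "Cc (ker2 c \<delta> a b)" "Cc (ker3 c \<delta> a b d)"
proof -
  have *: "continuous_on UNIV (ker0 c \<delta>)" "continuous_on UNIV (ker1 c \<delta> a)"
      "continuous_on UNIV (ker2 c \<delta> a b)" "continuous_on UNIV (ker3 c \<delta> a b d)"
    unfolding ker0_def[abs_def] ker1_def[abs_def] ker2_def[abs_def] ker3_def[abs_def]
        by (intro continuous_intros)+
  show "Cc (ker0 c \<delta>)" "Cc (ker1 c \<delta> a)" "Cc (ker2 c \<delta> a b)" "Cc (ker3 c \<delta> a b d)"
    by (rule ccI[of _ "\<bar>\<delta>\<bar>"], rule *, simp add: ker_zero)+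
qed

lemma conv_ker_has_derivative:
  assumes "Cc F"
  shows "(conv F (ker0 c \<delta>) has_derivative (\<lambda>v. conv F (ker1 c \<delta> v) x)) (at x)"
    "(conv F (ker1 c \<delta> a) has_derivative (\<lambda>v. conv F (ker2 c \<delta> a v) x)) (at x)"
    "(conv F (ker2 c \<delta> a b) has_derivative (\<lambda>v. conv F (ker3 c \<delta> a b v) x)) (at x)"
  by (intro conv_has_derivative assms ker0_has_derivative ker1_has_derivative ker2_has_derivative
      Cc_continuous ker_Cc)+

text \<open>Assembles directional derivatives into the operator-valued ones that
  \<open>C2_on\<close> asks for. The first argument of \<open>D2 x\<close> is the direction in which
  \<open>D1\<close> is differentiated; \<open>sym\<close> brings the two directions into the stated
  order.\<close>

lemma C2_blinfun:
  fixes f :: "'a::euclidean_space \<Rightarrow> real"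
  assumes 1: "\<And>z. (f has_derivative (\<lambda>v. f1 v z)) (at z)" and 2:
      "\<And>a z. (f1 a has_derivative (\<lambda>v. f2 a v z)) (at z)"
    and c: "\<And>a b. continuous_on UNIV (f2 a b)" and sym: "\<And>a b. f2 a b = f2 b a"
  obtains D1 :: "'a \<Rightarrow> ('a \<Rightarrow>\<^sub>L real)" and D2 :: "'a \<Rightarrow> ('a \<Rightarrow>\<^sub>L ('a \<Rightarrow>\<^sub>L real))"
  where "\<And>x. (f has_derivative blinfun_apply (D1 x)) (at x)"
      "\<And>x. (D1 has_derivative blinfun_apply (D2 x)) (at x)"
    "continuous_on UNIV D2" "\<And>x a b. D2 x a b = f2 a b x"
proof -
  have ex: "\<phi> v = (\<Sum>i\<in>Basis. (v \<bullet> i) * \<phi> i)" if lin: "linear \<phi>" for \<phi> :: "'a \<Rightarrow> real" and v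
  proof -
    have "\<phi> v = \<phi> (\<Sum>i\<in>Basis. (v \<bullet> i) *\<^sub>R i)" by (simp add: euclidean_representation)
    also have "\<dots> = (\<Sum>i\<in>Basis. (v \<bullet> i) * \<phi> i)"
      by (simp only: linear_sum[OF lin] linear_scale[OF lin] real_scaleR_def)
    finally show ?thesis .
  qed
  have l1: "linear (\<lambda>v. f1 v z)" for z using has_derivative_linear[OF 1] .
  have l2: "linear (\<lambda>v. f2 a v z)" for a z using has_derivative_linear[OF 2] .
  define D1 where "D1 = (\<lambda>x. \<Sum>i\<in>Basis. f1 i x *\<^sub>R blinfun_inner_left i :: 'a \<Rightarrow>\<^sub>L real)"
  define D2 where "D2 = (\<lambda>x. \<Sum>i\<in>Basis. \<Sum>j\<in>Basis. f2 i j x *\<^sub>R (blinfun_scaleR_left (blinfun_inner_left i)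
      o\<^sub>L blinfun_inner_left j) :: 'a \<Rightarrow>\<^sub>L 'a \<Rightarrow>\<^sub>L real)"
  have D2v: "blinfun_apply (D2 x) v = (\<Sum>i\<in>Basis. f2 i v x *\<^sub>R blinfun_inner_left i)" for x v
    by (simp add: D2_def blinfun.sum_left blinfun.scaleR_left ex[OF l2, where v
        = v] scaleR_sum_left mult.commute)
  show ?thesis
  proof (rule that)
    fix x
    have "blinfun_apply (D1 x) v = f1 v x" for v
      using ex[OF l1[of x], of v] by (simp add: D1_def blinfun.sum_left blinfun.scaleR_left mult.commute)
    then have "blinfun_apply (D1 x) = (\<lambda>v. f1 v x)" ..
    then show "(f has_derivative blinfun_apply (D1 x)) (at x)" using 1 by simp
    have "(D1 has_derivative (\<lambda>v. \<Sum>i\<in>Basis. f2 i v x *\<^sub>R blinfun_inner_left i)) (at x)"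
      unfolding D1_def by (intro has_derivative_sum has_derivative_scaleR_left 2)
    then show "(D1 has_derivative blinfun_apply (D2 x)) (at x)"
      by (simp add: D2v[abs_def])
  next
    show "continuous_on UNIV D2" unfolding D2_def by (intro continuous_intros c)
    fix x a b
    have "D2 x a b = (\<Sum>i\<in>Basis. (b \<bullet> i) * f2 a i x)"
      by (simp add: D2v blinfun.sum_left blinfun.scaleR_left sym[of _ a] mult.commute)
    then show "D2 x a b = f2 a b x" using ex[OF l2[of a x], of b] by simp
  qed
qed

lemma conv_ker_C2:
  fixes F :: "'a::euclidean_space \<Rightarrow> real"
  assumes F: "Cc F"
  obtains D1 :: "'a \<Rightarrow> ('a \<Rightarrow>\<^sub>L real)" and D2 :: "'a \<Rightarrow> ('a \<Rightarrow>\<^sub>L ('a \<Rightarrow>\<^sub>L real))"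
  where "\<And>x. (conv F (ker0 c \<delta>) has_derivative blinfun_apply (D1 x)) (at x)"
      "\<And>x. (D1 has_derivative blinfun_apply (D2 x)) (at x)"
    "continuous_on UNIV D2" "\<And>x a b. D2 x a b = conv F (ker2 c \<delta> a b) x"
proof (rule C2_blinfun[where f = "conv F (ker0 c \<delta>)" and ?f1.0 = "\<lambda>v. conv F (ker1 c \<delta> v)" and ?f2.0 =
    "\<lambda>a b. conv F (ker2 c \<delta> a b)"])
  show "continuous_on UNIV (conv F (ker2 c \<delta> a b))" for a b by (intro conv_continuous F Cc_continuous ker_Cc)
  show "conv F (ker2 c \<delta> a b) = conv F (ker2 c \<delta> b a)" for a b by (simp add: ker2_sym)
qed (use that conv_ker_has_derivative[OF F] in auto)

lemma C2_on_conv_ker: "Cc F \<Longrightarrow> C2_on U (conv F (ker0 c \<delta>))"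
proof -
  assume F: "Cc F"
  obtain D1 D2 where D: "\<And>x. (conv F (ker0 c \<delta>) has_derivative blinfun_apply (D1 x)) (at x)"
      "\<And>x. (D1 has_derivative blinfun_apply (D2 x)) (at x)"
    "continuous_on UNIV D2"
    using conv_ker_C2[OF F] by metis
  show ?thesis unfolding C2_on_def
    by (intro exI[of _ D1] exI[of _ D2] conjI ballI D continuous_on_subset[OF D(3)]) auto
qed

lemma hessO_conv_ker: assumes "Cc F" shows "hessO (conv F (ker0 c \<delta>)) x = hmat (\<lambda>h k. conv F (ker2 c \<delta> h k) x)"
proof -
  obtain D1 D2 where D: "\<And>x. (conv F (ker0 c \<delta>) has_derivative blinfun_apply (D1 x)) (at x)"
      "\<And>x. (D1 has_derivative blinfun_apply (D2 x)) (at x)"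
    "\<And>x a b. D2 x a b = conv F (ker2 c \<delta> a b) x"
    using conv_ker_C2[OF assms] by metis
  have "dd (conv F (ker0 c \<delta>)) h k x = conv F (ker2 c \<delta> h k) x" for h k
    using dd_eq_second_derivative[OF open_UNIV UNIV_I D(1) D(2), where x = x and h = h and k = k]
    unfolding ker2_sym[of c \<delta> h k] D(3) .
  then show ?thesis by (simp add: hessO_eq_hmat)
qed

lemma odet2_conv_ker_nonneg:
  assumes "Cc F" "open U" "x \<in> U" "opsh_cont U (conv F (ker0 c \<delta>))"
  shows "0 \<le> odet2 (hessO (conv F (ker0 c \<delta>)) x) (hessO (conv F (ker0 c \<delta>)) x)"
proof -
  obtain D1 D2 where D: "\<And>x. (conv F (ker0 c \<delta>) has_derivative blinfun_apply (D1 x)) (at x)"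
      "\<And>x. (D1 has_derivative blinfun_apply (D2 x)) (at x)"
    "\<And>x a b. D2 x a b = conv F (ker2 c \<delta> a b) x"
    using conv_ker_C2[OF assms(1)] by metis
  show ?thesis
    by (rule odet2_hessO_nonneg[OF assms(2,3) D(1) D(2) assms(4)]) (simp add: D(3) ker2_sym)
qed

text \<open>By \<open>odet2_hmat\<close> the integral is a combination of the numbers
  \<open>T a b d e\<close>. Symmetry of second derivatives gives the exchanges within each pair,
  integration by parts the exchange across the pairs.\<close>

lemma integral_odet2_conv_zero:
  fixes F G :: "pt \<Rightarrow> real"
  assumes F: "Cc F" and G: "Cc G"
  shows "integral\<^sup>L lborel (\<lambda>x. odet2 (hmat (\<lambda>h k. conv F (ker2 c \<delta> h k) x)) (hmat (\<lambda>h k. conv G (ker2 c \<delta> h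
      k) x))) = 0"
proof -
  define T where "T = (\<lambda>a b d e. integral\<^sup>L lborel (\<lambda>x. conv F (ker2 c \<delta> a b) x * conv G (ker2 c \<delta> d e) x))"
  have int[simp]: "integrable lborel (\<lambda>x. conv F (ker2 c \<delta> a b) x * conv G (ker2 c \<delta> d e) x)" for a b d e
    by (intro Cc_integrable Cc_mult_right conv_Cc F G Cc_continuous ker_Cc)
  have s12: "T a b d e = T b a d e" for a b d e by (simp add: T_def ker2_sym[of c \<delta> a b])
  have s34: "T a b d e = T a b e d" for a b d e by (simp add: T_def ker2_sym[of c \<delta> d e])
  \<comment> \<open>The derivative along \<open>d\<close> is taken off \<open>G\<close> and put on
    \<open>F\<close>. What results is a third derivative of \<open>F\<close>, symmetric in
    \<open>b\<close> and \<open>d\<close>, against a factor that involves only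
    \<open>e\<close>.\<close>
  have ibp: "T a b d e = - integral\<^sup>L lborel (\<lambda>x. conv F (ker3 c \<delta> a b d) x * conv G (ker1 c \<delta> e) x)" for a
      b d e
    unfolding T_def ker2_sym[of c \<delta> d e]
    by (rule integration_by_parts_Cc[where ?f1.0 = "\<lambda>v. conv F (ker3 c \<delta> a b v)" and ?g1.0 =
        "\<lambda>v. conv G (ker2 c \<delta> e v)"])
       (intro conv_Cc conv_ker_has_derivative conv_continuous F G Cc_continuous ker_Cc)+
  have s23: "T a b d e = T a d b e" for a b d e unfolding ibp by (simp add: ker3_sym[of c \<delta> a b d])
  have "integral\<^sup>L lborel (\<lambda>x. odet2 (hmat (\<lambda>h k. conv F (ker2 c \<delta> h k) x)) (hmat (\<lambda>h k. conv G (ker2 c \<delta> h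
      k) x)))
    = ((\<Sum>p<8. \<Sum>q<8. T (E 1 p) (E 1 p) (E 2 q) (E 2 q) + T (E 2 q) (E 2 q) (E 1 p) (E 1 p))) / 2
    - (\<Sum>p<8. \<Sum>q<8. \<Sum>p'<8. \<Sum>q'<8. T (E 1 p) (E 2 q) (E 2 q') (E 1 p') * oct_gram p q p' q')"
    unfolding odet2_hmat
    by (simp add: Bochner_Integration.integral_sum Bochner_Integration.integral_add
        Bochner_Integration.integral_diff T_def)
  also have "\<dots> = 0" by (rule null_lagrangian[OF s12 s34 s23])
  finally show ?thesis .
qed

section \<open>Mollified plurisubharmonic functions\<close>

lemma bump_integral_pos:
  assumes "\<delta> > 0" shows "0 < integral\<^sup>L lborel (bump \<delta> 4 :: 'a::euclidean_space \<Rightarrow> real)"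
proof -
  have i: "integrable lborel (bump \<delta> 4 :: 'a \<Rightarrow> real)"
    by (intro Cc_integrable ccI[of _ "\<bar>\<delta>\<bar>"] bump_continuous) (simp add: bump_zero)
  have "integral\<^sup>L lborel (bump \<delta> 4 :: 'a \<Rightarrow> real) \<noteq> 0"
  proof
    assume "integral\<^sup>L lborel (bump \<delta> 4 :: 'a \<Rightarrow> real) = 0"
    then have "AE x::'a in lborel. bump \<delta> 4 x = 0"
      by (subst (asm) integral_nonneg_eq_0_iff_AE[OF i]) (auto simp: bump_nonneg)
    moreover have "bump \<delta> 4 x \<noteq> 0" if "x \<in> ball 0 \<delta>" for x :: 'a
      using that power_strict_mono[of "norm x" \<delta> 2] by (simp add: bump_def power2_norm_eq_inner max_def)
    ultimately have "AE x::'a in lborel. x \<notin> ball 0 \<delta>"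
      by (auto elim: eventually_mono)
    then have "emeasure lborel (ball (0::'a) \<delta>) = 0"
      by (subst (asm) AE_iff_measurable[OF _ refl]) (auto simp: ball_def)
    then show False using content_ball_pos[OF assms, of "0::'a"] by (simp add: measure_def)
  qed
  then show ?thesis by (simp add: order_less_le Bochner_Integration.integral_nonneg bump_nonneg)
qed

definition mnorm :: "real \<Rightarrow> real" where
  "mnorm \<delta> = 1 / integral\<^sup>L lborel (bump \<delta> 4 :: pt \<Rightarrow> real)"

abbreviation mker :: "real \<Rightarrow> pt \<Rightarrow> real" where "mker \<delta> \<equiv> ker0 (mnorm \<delta>) \<delta>"
abbreviation moll :: "real \<Rightarrow> (pt \<Rightarrow> real) \<Rightarrow> pt \<Rightarrow> real" where "moll \<delta> F \<equiv> conv F (mker \<delta>)"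

lemma mker_nonneg: "\<delta> > 0 \<Longrightarrow> 0 \<le> mker \<delta> y"
  using bump_integral_pos[of \<delta>, where 'a = pt] by (simp add: ker0_def mnorm_def bump_nonneg)

lemma mker_integral: "\<delta> > 0 \<Longrightarrow> integral\<^sup>L lborel (mker \<delta>) = 1"
  using bump_integral_pos[of \<delta>, where 'a = pt] by (simp add: ker0_def[abs_def] mnorm_def)

lemma conv_commute:
  assumes "Cc h" "continuous_on UNIV k"
  shows "conv h k x = integral\<^sup>L lborel (\<lambda>y. h (x - y) * k y)"
  unfolding conv_def
  using lborel_reflect[OF Cc_continuous[OF conv_integrand_Cc[OF assms, where x = x]], where x = x] by simp

lemma moll_approx:
  assumes F: "Cc F" and e: "e > 0"
  obtains d where "d > 0" "\<And>\<delta> x. 0 < \<delta> \<Longrightarrow> \<delta> < d \<Longrightarrow> \<bar>moll \<delta> F x - F x\<bar> \<le> e"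
proof -
  obtain d where d: "d > 0" "\<And>x y. dist x y < d \<Longrightarrow> \<bar>F x - F y\<bar> < e"
    using Cc_uniformly_continuous[OF F e] by blast
  show ?thesis
  proof (rule that[OF d(1)])
    fix \<delta> x assume \<delta>: "0 < \<delta>" "\<delta> < d"
    have i1: "integrable lborel (\<lambda>y. F (x - y) * mker \<delta> y)"
      by (intro Cc_integrable Cc_mult_left ker_Cc Cc_continuous[OF Cc_shift[OF F]])
    have i2: "integrable lborel (mker \<delta>)" by (intro Cc_integrable ker_Cc)
    have "moll \<delta> F x - F x = integral\<^sup>L lborel (\<lambda>y. F (x - y) * mker \<delta> y) - F x * integral\<^sup>L lborel (mker \<delta>)"
      using conv_commute[OF F Cc_continuous[OF ker_Cc(1)]] mker_integral[OF \<delta>(1)] by simp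
    also have "\<dots> = integral\<^sup>L lborel (\<lambda>y. F (x - y) * mker \<delta> y - F x * mker \<delta> y)"
      using i1 i2 by simp
    finally have "\<bar>moll \<delta> F x - F x\<bar> \<le> integral\<^sup>L lborel (\<lambda>y. \<bar>F (x - y) * mker \<delta> y - F x * mker \<delta> y\<bar>)"
      by (simp only: integral_abs_bound)
    also have "\<dots> \<le> integral\<^sup>L lborel (\<lambda>y. e * mker \<delta> y)"
    proof (rule integral_mono)
      show "integrable lborel (\<lambda>y. \<bar>F (x - y) * mker \<delta> y - F x * mker \<delta> y\<bar>)" using i1 i2 by simp
      show "integrable lborel (\<lambda>y. e * mker \<delta> y)" using i2 by simp
      fix y :: pt
      show "\<bar>F (x - y) * mker \<delta> y - F x * mker \<delta> y\<bar> \<le> e * mker \<delta> y"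
      proof (cases "norm y < \<delta>")
        case True
        then have "\<bar>F (x - y) - F x\<bar> \<le> e" using d(2)[of "x - y" x] \<delta> by (simp add: dist_norm less_imp_le)
        then have "\<bar>F (x - y) - F x\<bar> * mker \<delta> y \<le> e * mker \<delta> y" by (intro mult_right_mono mker_nonneg \<delta>)
        then show ?thesis using mker_nonneg[OF \<delta>(1), of y] by (simp add: left_diff_distrib[symmetric] abs_mult)
      next
        case False
        then show ?thesis using ker_zero(1)[of \<delta> y] \<delta> by simp
      qed
    qed
    also have "\<dots> = e" using mker_integral[OF \<delta>(1)] by simp
    finally show "\<bar>moll \<delta> F x - F x\<bar> \<le> e" .
  qed
qed

lemma integral_cball_lborel:
  fixes w :: "'a::euclidean_space \<Rightarrow> real"
  assumes "continuous_on (cball c r) w"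
  shows "integral (cball c r) w = integral\<^sup>L lborel (\<lambda>x. indicator (cball c r) x * w x)"
  using set_borel_integral_eq_integral(2)[of "cball c r" w] borel_integrable_compact[OF compact_cball assms]
  by (simp add: set_lebesgue_integral_def set_integrable_def)

text \<open>A mollification is an average of translates with nonnegative weights. Each translate by
  at most \<open>\<delta>\<close> satisfies the sub-mean-value inequality, and Fubini's theorem
  exchanges the average with the integral over the ball. Hypothesis \<open>W\<close> keeps these
  translates where \<open>F\<close> agrees with \<open>u\<close>.\<close>

lemma opsh_moll:
  assumes F: "Cc F" and \<delta>: "\<delta> > 0" and u: "opsh_cont U u"
    and W: "\<And>x y. x \<in> W \<Longrightarrow> norm y \<le> \<delta> \<Longrightarrow> x - y \<in> U \<and> F (x - y) = u (x - y)"
  shows "opsh_cont W (moll \<delta> F)"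
  unfolding opsh_cont_def
proof (intro conjI allI)
  show "continuous_on W (moll \<delta> F)" by (intro conv_continuous F Cc_continuous ker_Cc)
  fix c a
  define L where "L = oline a"
  have bL: "bounded_linear L" using oline_linear by (simp add: L_def linear_conv_bounded_linear)
  have contL: "continuous_on A L" for A using bL by (rule linear_continuous_on)
  show "subharmonic_on {x. c + oline a x \<in> W} (\<lambda>x. moll \<delta> F (c + oline a x))"
    unfolding subharmonic_on_def L_def[symmetric]
  proof (intro allI impI)
    fix c0 :: oct and r :: real
    assume r: "0 < r \<and> cball c0 r \<subseteq> {x. c + L x \<in> W}"
    let ?B = "cball c0 r"
    define b where "b = measure lborel ?B"
    have inW: "c + L x \<in> W" if "x \<in> ?B" for x using r that by auto
    have contF: "continuous_on UNIV (\<lambda>p. F (c + L (fst p) - snd p))"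
      by (intro continuous_on_compose2[OF Cc_continuous[OF F, of UNIV]] continuous_intros
          continuous_on_compose2[OF contL[of UNIV]]) auto
    have contk: "continuous_on UNIV (\<lambda>p::oct \<times> pt. mker \<delta> (snd p))"
      by (intro continuous_on_compose2[OF Cc_continuous[OF ker_Cc(1), of UNIV]] continuous_intros) auto
    define f where "f = (\<lambda>x y. indicator ?B x * (F (c + L x - y) * mker \<delta> y))"
    have kz: "mker \<delta> y = 0" if "\<not> norm y \<le> \<delta>" for y :: pt using ker_zero(1)[of \<delta> y] that \<delta> by simp
    have int: "integrable (lborel \<Otimes>\<^sub>M lborel) (case_prod f)"
    proof -
      have "integrable lborel (\<lambda>p. indicator (?B \<times> cball 0 \<delta>) p *\<^sub>R (F (c
          + L (fst p) - snd p) * mker \<delta> (snd p)))"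
        using contF contk
        by (intro borel_integrable_compact compact_Times compact_cball continuous_on_mult) (auto
            intro: continuous_on_subset)
      moreover have "(\<lambda>p. indicator (?B \<times> cball 0 \<delta>) p *\<^sub>R (F (c + L (fst p) - snd p) * mker \<delta> (snd p)))
          = case_prod f"
        using kz by (auto simp: f_def indicator_def fun_eq_iff)
      ultimately show ?thesis by (simp add: lborel_prod)
    qed
    have inner: "mker \<delta> y * (F (c + L c0 - y) * b) \<le> integral\<^sup>L lborel (\<lambda>x. f x y)" for y
    proof (cases "norm y \<le> \<delta>")
      case True
      have *: "c - y + L x \<in> U" "F (c + L x - y) = u (c - y + L x)" if "x \<in> ?B" for x
        using W[OF inW[OF that] True] by (simp_all add: algebra_simps)
      have cont: "continuous_on ?B (\<lambda>x. u (c - y + L x))"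
        using u * unfolding opsh_cont_def
        by (intro continuous_on_compose2[of U u ?B "\<lambda>x. c - y + L x"] continuous_intros contL) auto
      have "subharmonic_on {x. (c - y) + L x \<in> U} (\<lambda>x. u ((c - y) + L x))"
        using u unfolding opsh_cont_def L_def by blast
      moreover have "?B \<subseteq> {x. c - y + L x \<in> U}" using * by auto
      ultimately have "u (c - y + L c0) * b \<le> integral ?B (\<lambda>x. u (c - y + L x))"
        using r unfolding subharmonic_on_def b_def by blast
      also have "\<dots> = integral\<^sup>L lborel (\<lambda>x. indicator ?B x * u (c - y + L x))"
        by (rule integral_cball_lborel[OF cont])
      also have "\<dots> = integral\<^sup>L lborel (\<lambda>x. indicator ?B x * F (c + L x - y))"
        by (rule Bochner_Integration.integral_cong) (auto simp: indicator_def *(2))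
      finally have "u (c - y + L c0) * b \<le> integral\<^sup>L lborel (\<lambda>x. indicator ?B x * F (c + L x - y))" .
      moreover have "u (c - y + L c0) = F (c + L c0 - y)" using *(2)[of c0] r by simp
      moreover have "integral\<^sup>L lborel (\<lambda>x. f x y) = mker \<delta> y * integral\<^sup>L lborel (\<lambda>x. indicator ?B x * F (c
          + L x - y))"
        unfolding f_def integral_mult_right_zero[symmetric] by (rule Bochner_Integration.integral_cong) auto
      ultimately show ?thesis using mker_nonneg[OF \<delta>, of y] by (simp add: mult_left_mono)
    next
      case False
      then show ?thesis using ker_zero(1)[of \<delta> y] \<delta> by (simp add: f_def)
    qed
    have contm: "continuous_on ?B (\<lambda>x. moll \<delta> F (c + L x))"
      by (intro continuous_on_compose2[OF conv_continuous[OF F Cc_continuous[OF ker_Cc(1)], of UNIV]]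
          continuous_intros contL) auto
    have "moll \<delta> F (c + L c0) * measure lborel ?B = integral\<^sup>L lborel (\<lambda>y. mker \<delta> y * (F (c + L c0 - y) * b))"
      unfolding conv_commute[OF F Cc_continuous[OF ker_Cc(1)]] b_def[symmetric]
          integral_mult_left_zero[symmetric]
      by (rule Bochner_Integration.integral_cong) auto
    also have "\<dots> \<le> integral\<^sup>L lborel (\<lambda>y. integral\<^sup>L lborel (\<lambda>x. f x y))"
    proof (rule integral_mono)
      show "integrable lborel (\<lambda>y. mker \<delta> y * (F (c + L c0 - y) * b))"
        by (intro Cc_integrable Cc_mult_right ker_Cc continuous_intros Cc_continuous[OF Cc_shift[OF F]])
      show "integrable lborel (\<lambda>y. integral\<^sup>L lborel (\<lambda>x. f x y))"
        by (rule lborel_pair.integrable_snd[OF int])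
    qed (rule inner)
    also have "\<dots> = integral\<^sup>L lborel (\<lambda>x. integral\<^sup>L lborel (\<lambda>y. f x y))"
      by (rule lborel_pair.Fubini_integral[OF int])
    also have "\<dots> = integral\<^sup>L lborel (\<lambda>x. indicator ?B x * moll \<delta> F (c + L x))"
      unfolding conv_commute[OF F Cc_continuous[OF ker_Cc(1)]] f_def by simp
    also have "\<dots> = integral ?B (\<lambda>x. moll \<delta> F (c + L x))"
      by (rule integral_cball_lborel[OF contm, symmetric])
    finally show "moll \<delta> F (c + L c0) * measure lborel ?B \<le> integral ?B (\<lambda>x. moll \<delta> F (c + L x))" .
  qed
qed

section \<open>Linearity of convolutions and Hessians, and polarisation of the determinant\<close>

lemma conv_add:
  assumes "Cc F" "Cc G" "continuous_on UNIV k"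
  shows "conv (\<lambda>y. F y + G y) k x = conv F k x + conv G k x"
  using Cc_integrable[OF conv_integrand_Cc[OF assms(1,3), of x]] Cc_integrable[OF conv_integrand_Cc[OF
      assms(2,3), of x]]
  unfolding conv_def by (simp add: distrib_right)

lemma conv_diff:
  assumes "Cc F" "Cc G" "continuous_on UNIV k"
  shows "conv (\<lambda>y. F y - G y) k x = conv F k x - conv G k x"
  using Cc_integrable[OF conv_integrand_Cc[OF assms(1,3), of x]] Cc_integrable[OF conv_integrand_Cc[OF
      assms(2,3), of x]]
  unfolding conv_def by (simp add: left_diff_distrib)

lemma hmat_add: "hmat (\<lambda>h k. A h k + B h k) \<alpha> \<beta> = hmat A \<alpha> \<beta> + hmat B \<alpha> \<beta>"
  by (simp add: hmat_def scaleR_add_left sum.distrib)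

lemma hmat_diff: "hmat (\<lambda>h k. A h k - B h k) \<alpha> \<beta> = hmat A \<alpha> \<beta> - hmat B \<alpha> \<beta>"
  by (simp add: hmat_def scaleR_diff_left sum_subtractf)

text \<open>Symmetric forms give Hermitian matrices, and on these \<open>odet2\<close> is a
  symmetric bilinear form, so a difference of squares factors.\<close>

lemma odet2_square_diff:
  assumes A: "\<And>h k. A h k = A k h" and B: "\<And>h k. B h k = B k h"
  shows "odet2 (hmat A) (hmat A) - odet2 (hmat B) (hmat B)
      = odet2 (hmat (\<lambda>h k. A h k - B h k)) (hmat (\<lambda>h k. A h k + B h k))"
proof -
  have *: "odet2 (hmat X) (hmat Y) = (ore (hmat X 1 1) * ore (hmat Y 2 2) + ore (hmat X 2 2) * ore (hmat Y 1 1)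
     - 2 * (hmat X 1 2 \<bullet> hmat Y 1 2)) / 2" if "\<And>h k. Y h k = Y k h" for X Y
    using that by (simp add: odet2_def ore_omul oconj_hmat)
  have o: "ore (x + y) = ore x + ore y" "ore (x - y) = ore x - ore y" for x y
      by (simp_all add: ore_def ocoord_def)
  have s: "A h k + B h k = A k h + B k h" for h k using A B by metis
  show ?thesis
    unfolding *[of A A, OF A] *[of B B, OF B] *[of "\<lambda>h k. A h k + B h k", OF s] hmat_add hmat_diff o
    by (simp add: inner_diff_left inner_diff_right inner_add_left inner_add_right inner_commute field_simps)
qed

section \<open>Operations that preserve plurisubharmonicity\<close>

lemma opsh_line_continuous:
  assumes "opsh_cont U w" "S \<subseteq> {x. c + oline a x \<in> U}"
  shows "continuous_on S (\<lambda>x. w (c + oline a x))"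
proof -
  have "bounded_linear (oline a)" using oline_linear by (simp add: linear_conv_bounded_linear)
  then have "continuous_on S (\<lambda>x. c + oline a x)" by (intro continuous_intros linear_continuous_on)
  moreover have "continuous_on U w" using assms(1) by (simp add: opsh_cont_def)
  ultimately show ?thesis using assms(2) by (intro continuous_on_compose2[of U w S "\<lambda>x. c + oline a x"]) auto
qed

lemma opsh_submean:
  assumes "opsh_cont U w" "0 < r" "cball c0 r \<subseteq> {x. c + oline a x \<in> U}"
  shows "w (c + oline a c0) * measure lborel (cball c0 r) \<le> integral (cball c0 r) (\<lambda>x. w (c + oline a x))"
proof -
  have "subharmonic_on {x. c + oline a x \<in> U} (\<lambda>x. w (c + oline a x))"
    using assms(1) unfolding opsh_cont_def by blast
  then show ?thesis using assms(2,3) unfolding subharmonic_on_def by simp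
qed

lemma opsh_contI:
  assumes "continuous_on U w"
    and "\<And>c a c0 r. 0 < r \<Longrightarrow> cball c0 r \<subseteq> {x. c + oline a x \<in> U} \<Longrightarrow>
      w (c + oline a c0) * measure lborel (cball c0 r) \<le> integral (cball c0 r) (\<lambda>x. w (c + oline a x))"
  shows "opsh_cont U w"
  unfolding opsh_cont_def subharmonic_on_def using assms by auto

lemma opsh_cont_subset:
  assumes "opsh_cont U u" "W \<subseteq> U" shows "opsh_cont W u"
proof (rule opsh_contI)
  show "continuous_on W u" using assms continuous_on_subset unfolding opsh_cont_def by blast
  fix c a c0 r
  assume r: "0 < r" "cball c0 r \<subseteq> {x. c + oline a x \<in> W}"
  then have "cball c0 r \<subseteq> {x. c + oline a x \<in> U}" using assms(2) by blast
  then show "u (c + oline a c0) * measure lborel (cball c0 r) \<le> integral (cball c0 r) (\<lambda>x. u (c + oline a x))"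
    by (rule opsh_submean[OF assms(1) r(1)])
qed

lemma continuous_integrable_cball:
  fixes w :: "'a::euclidean_space \<Rightarrow> real"
  shows "continuous_on (cball c r) w \<Longrightarrow> w integrable_on cball c r"
  using borel_integrable_compact[OF compact_cball, of c r w]
  by (intro set_borel_integral_eq_integral(1)) (simp add: set_integrable_def)

lemma opsh_cont_diff_const:
  assumes "opsh_cont U u" shows "opsh_cont U (\<lambda>x. u x - e)"
proof (rule opsh_contI)
  show "continuous_on U (\<lambda>x. u x - e)"
    using assms by (intro continuous_on_diff continuous_on_const) (simp add: opsh_cont_def)
  fix c a c0 r
  assume r: "0 < r" "cball c0 r \<subseteq> {x. c + oline a x \<in> U}"
  have "integral (cball c0 r) (\<lambda>x. u (c + oline a x) - e)
    = integral (cball c0 r) (\<lambda>x. u (c + oline a x)) - integral (cball c0 r) (\<lambda>x. e)"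
    by (rule Henstock_Kurzweil_Integration.integral_diff[OF continuous_integrable_cball[OF
        opsh_line_continuous[OF assms r(2)]] continuous_integrable_cball[OF continuous_on_const]])
  also have "integral (cball c0 r) (\<lambda>x. e) = e * measure lborel (cball c0 r)"
    by (simp add: integral_cball_lborel)
  finally show "(u (c + oline a c0) - e) * measure lborel (cball c0 r) \<le> integral (cball c0 r) (\<lambda>x. u (c
      + oline a x) - e)"
    using opsh_submean[OF assms r] by (simp add: algebra_simps)
qed

lemma opsh_cont_max:
  assumes u: "opsh_cont U u" and v: "opsh_cont U v" shows "opsh_cont U (\<lambda>x. max (u x) (v x))"
proof (rule opsh_contI)
  show "continuous_on U (\<lambda>x. max (u x) (v x))"
    using assms by (intro continuous_on_max) (simp_all add: opsh_cont_def)
  fix c a c0 r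
  assume r: "0 < r" "cball c0 r \<subseteq> {x. c + oline a x \<in> U}"
  have "w (c + oline a c0) * measure lborel (cball c0 r) \<le> integral (cball c0 r) (\<lambda>x. max (u (c
      + oline a x)) (v (c + oline a x)))"
    if w: "opsh_cont U w" "\<And>x. w x \<le> max (u x) (v x)" for w
  proof -
    have ci: "continuous_on (cball c0 r) (\<lambda>x. max (u (c + oline a x)) (v (c + oline a x)))"
      by (rule continuous_on_max[OF opsh_line_continuous[OF u r(2)] opsh_line_continuous[OF v r(2)]])
    note opsh_submean[OF w(1) r]
    also have "integral (cball c0 r) (\<lambda>x. w (c + oline a x)) \<le> integral (cball c0 r) (\<lambda>x. max (u (c
        + oline a x)) (v (c + oline a x)))"
      by (rule integral_le[OF continuous_integrable_cball[OF opsh_line_continuous[OF w(1) r(2)]]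
          continuous_integrable_cball[OF ci] w(2)])
    finally show ?thesis .
  qed
  from this[OF u] this[OF v]
  show "max (u (c + oline a c0)) (v (c + oline a c0)) * measure lborel (cball c0 r)
    \<le> integral (cball c0 r) (\<lambda>x. max (u (c + oline a x)) (v (c + oline a x)))"
    by (simp add: max_def)
qed

section \<open>The comparison principle\<close>

lemma cutoff_exists:
  fixes C G :: "'a::euclidean_space set"
  assumes C: "compact C" and G: "open G" "C \<subseteq> G"
  obtains \<theta> :: "'a \<Rightarrow> real" and e where "e > 0" "continuous_on UNIV \<theta>" "\<And>x. 0 \<le> \<theta> x" "\<And>x. \<theta> x \<le> 1"
    "\<And>c x. c \<in> C \<Longrightarrow> dist c x \<le> e \<Longrightarrow> \<theta> x = 1" "compact (closure {x. \<theta> x \<noteq> 0})" "closure {x. \<theta> x \<noteq> 0} \<subseteq> G"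
proof (cases "C = {}")
  case True
  \<comment> \<open>\<open>infdist\<close> to the empty set is 0, so the formula of the other case
    would give the constant 1.\<close>
  show ?thesis by (rule that[of 1 "\<lambda>_. 0"]) (auto simp: True)
next
  case False
  obtain e0 where e0: "e0 > 0" "(\<Union>x\<in>C. cball x e0) \<subseteq> G"
    using compact_subset_open_imp_cball_epsilon_subset[OF C G] by blast
  define e where "e = e0 / 2"
  have e: "e > 0" "2 * e \<le> e0" using e0 by (auto simp: e_def)
  \<comment> \<open>Equal to 1 up to distance \<open>e\<close> from \<open>C\<close> and 0 from
    distance \<open>2 * e\<close> on, which is at most \<open>e0\<close>. The collar of width
    \<open>e\<close> leaves room for mollification.\<close>
  define \<theta> where "\<theta> = (\<lambda>x. max 0 (min 1 (2 - infdist x C / e)))"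
  have cpt: "compact {x. infdist x C \<le> 2 * e}" using False C e by (intro compact_infdist_le) auto
  have supp: "closure {x. \<theta> x \<noteq> 0} \<subseteq> {x. infdist x C \<le> 2 * e}"
  proof (rule closure_minimal)
    show "{x. \<theta> x \<noteq> 0} \<subseteq> {x. infdist x C \<le> 2 * e}"
      using e by (auto simp: \<theta>_def max_def min_def field_simps split: if_splits)
    show "closed {x. infdist x C \<le> 2 * e}" using cpt by (rule compact_imp_closed)
  qed
  show ?thesis
  proof (rule that[of e \<theta>])
    show "e > 0" by fact
    show "continuous_on UNIV \<theta>" unfolding \<theta>_def using e by (intro continuous_intros) auto
    show "0 \<le> \<theta> x" "\<theta> x \<le> 1" for x by (auto simp: \<theta>_def)
    show "\<theta> x = 1" if "c \<in> C" "dist c x \<le> e" for c x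
    proof -
      have "infdist x C \<le> e" using infdist_le[OF that(1), of x] that(2) by (simp add: dist_commute)
      then show ?thesis using e by (simp add: \<theta>_def field_simps)
    qed
    show "compact (closure {x. \<theta> x \<noteq> 0})"
      using closed_Int_compact[OF closed_closure[of "{x. \<theta> x \<noteq> 0}"] cpt] supp by (simp add: Int_absorb2)
    show "closure {x. \<theta> x \<noteq> 0} \<subseteq> G"
    proof
      fix x assume "x \<in> closure {x. \<theta> x \<noteq> 0}"
      then have "infdist x C \<le> 2 * e" using supp by auto
      moreover obtain c where "c \<in> C" "infdist x C = dist x c"
        using infdist_attains_inf[OF compact_imp_closed[OF C] False] by metis
      ultimately have "x \<in> cball c e0" using e by (simp add: dist_commute)
      then show "x \<in> G" using e0 \<open>c \<in> C\<close> by blast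
    qed
  qed
qed

lemma Cc_compact_support:
  fixes f :: "'a::euclidean_space \<Rightarrow> real"
  assumes "continuous_on UNIV f" "compact (closure {x. f x \<noteq> 0})" shows "Cc f"
proof -
  obtain R where R: "\<forall>x\<in>closure {x. f x \<noteq> 0}. norm x \<le> R"
    using compact_imp_bounded[OF assms(2)] unfolding bounded_iff by blast
  show ?thesis
  proof (rule ccI[OF assms(1), of R])
    fix x :: 'a assume "norm x > R"
    then have "x \<notin> closure {x. f x \<noteq> 0}" using R by force
    then show "f x = 0" using closure_subset[of "{x. f x \<noteq> 0}"] by auto
  qed
qed

text \<open>\<open>u\<close> is continuous on \<open>G\<close> only. But \<open>G\<close> and the
  complement of the support of \<open>\<theta>\<close> are open and cover the space, and on the
  latter the function is constantly 0.\<close>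

lemma cutoff_mult_Cc:
  fixes \<theta> u :: "'a::euclidean_space \<Rightarrow> real"
  assumes G: "open G" and u: "continuous_on G u" and \<theta>: "continuous_on UNIV \<theta>"
    and supp: "compact (closure {x. \<theta> x \<noteq> 0})" "closure {x. \<theta> x \<noteq> 0} \<subseteq> G"
  shows "Cc (\<lambda>x. if x \<in> G then \<theta> x * u x else 0)" (is "Cc ?f")
proof -
  have "continuous_on G ?f"
    using continuous_on_mult[OF continuous_on_subset[OF \<theta> subset_UNIV] u] by (rule continuous_on_eq) auto
  moreover have "continuous_on (- closure {x. \<theta> x \<noteq> 0}) ?f"
    by (rule continuous_on_eq[OF continuous_on_const[of _ 0]]) (use closure_subset[of "{x. \<theta> x \<noteq> 0}"] in auto)
  ultimately have "continuous_on (G \<union> - closure {x. \<theta> x \<noteq> 0}) ?f"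
    using G by (intro continuous_on_open_Un) auto
  moreover have "G \<union> - closure {x. \<theta> x \<noteq> 0} = UNIV" using supp by auto
  ultimately have c: "continuous_on UNIV ?f" by simp
  obtain R where "\<And>x. norm x > R \<Longrightarrow> \<theta> x = 0" using Cc_bound[OF Cc_compact_support[OF \<theta> supp(1)]] by blast
  then show ?thesis by (intro ccI[OF c, of R]) auto
qed

section \<open>Consequences of the characterising properties of the measure\<close>

lemma mixed_MA_properties:
  assumes MA: "is_mixed_MA M" and U: "open U" and u: "opsh_cont U u" and v: "opsh_cont U v"
  shows "sets (M U u v) = sets lborel"
    "\<And>K. compact K \<Longrightarrow> K \<subseteq> U \<Longrightarrow> emeasure (M U u v) K < \<infinity>"
    "C2_on U u \<Longrightarrow> C2_on U v \<Longrightarrow>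
       M U u v = density lborel (\<lambda>x. ennreal (indicator U x * odet2 (hessO u x) (hessO v x)))"
    "\<And>W A. open W \<Longrightarrow> W \<subseteq> U \<Longrightarrow> A \<in> sets lborel \<Longrightarrow> emeasure (M W u v) A = emeasure (M U u v) (A \<inter> W)"
proof -
  note p = MA[unfolded is_mixed_MA_def]
  note p1 = p[THEN conjunct1, rule_format, of U u v]
  note p2 = p[THEN conjunct2, THEN conjunct1, rule_format, of U u v]
  note p4 = p[THEN conjunct2, THEN conjunct2, THEN conjunct2, rule_format, of U _ u v]
  show "sets (M U u v) = sets lborel" using p1 U u v by simp
  show "emeasure (M U u v) K < \<infinity>" if "compact K" "K \<subseteq> U" for K using p1 U u v that by simp
  show "M U u v = density lborel (\<lambda>x. ennreal (indicator U x * odet2 (hessO u x) (hessO v x)))"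
    if "C2_on U u" "C2_on U v" using p2 U u v that by simp
  show "emeasure (M W u v) A = emeasure (M U u v) (A \<inter> W)" if "open W" "W \<subseteq> U" "A \<in> sets lborel" for W A
    using p4[of W A] U u v that by simp
qed

lemma mixed_MA_weak_conv:
  fixes \<phi> :: "pt \<Rightarrow> real"
  assumes MA: "is_mixed_MA M" and U: "open U" "opsh_cont U u" "\<And>n. opsh_cont U (us n)"
      "locally_uniform_conv U us u"
    and \<phi>: "continuous_on UNIV \<phi>" "compact (closure {x. \<phi> x \<noteq> 0})" "closure {x. \<phi> x \<noteq> 0} \<subseteq> U"
  shows "(\<lambda>n. integral\<^sup>L (M U (us n) (us n)) \<phi>) \<longlonglongrightarrow> integral\<^sup>L (M U u u) \<phi>"
proof -
  note p = MA[unfolded is_mixed_MA_def]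
  have "weak_conv_on U (\<lambda>n. M U (us n) (us n)) (M U u u)"
    using p[THEN conjunct2, THEN conjunct2, THEN conjunct1, rule_format, of U us us u u] U by simp
  from this[unfolded weak_conv_on_def, rule_format, OF conjI[OF \<phi>(1) conjI[OF \<phi>(2,3)]]] show ?thesis .
qed

text \<open>Locality says that \<open>M W u u\<close> is the restriction of \<open>M U u u\<close>
  to \<open>W\<close>; written as a density, this carries over to integrals of functions that vanish
  off \<open>W\<close>.\<close>

lemma mixed_MA_integral_localize:
  assumes MA: "is_mixed_MA M" and U: "open U" "opsh_cont U u" and W: "open W" "W \<subseteq> U"
    and \<phi>: "\<phi> \<in> borel_measurable borel" "\<And>x. x \<notin> W \<Longrightarrow> \<phi> x = (0::real)"
  shows "integral\<^sup>L (M W u u) \<phi> = integral\<^sup>L (M U u u) \<phi>"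
proof -
  note U' = mixed_MA_properties[OF MA U(1) U(2) U(2)]
  note W' = mixed_MA_properties[OF MA W(1) opsh_cont_subset[OF U(2) W(2)] opsh_cont_subset[OF U(2) W(2)]]
  have Wm: "W \<in> sets (M U u u)" using W U'(1) by simp
  have "M W u u = density (M U u u) (indicator W)"
  proof (rule measure_eqI)
    show "sets (M W u u) = sets (density (M U u u) (indicator W))" by (simp add: U' W')
    fix A assume "A \<in> sets (M W u u)"
    then have A: "A \<in> sets lborel" by (simp add: W')
    have "emeasure (density (M U u u) (indicator W)) A = (\<integral>\<^sup>+x. indicator W x * indicator A x \<partial>M U u u)"
      using A Wm U'(1) by (intro emeasure_density) auto
    also have "\<dots> = (\<integral>\<^sup>+x. indicator (A \<inter> W) x \<partial>M U u u)"
      by (intro nn_integral_cong) (auto simp: indicator_def)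
    also have "\<dots> = emeasure (M U u u) (A \<inter> W)"
      using A Wm U'(1) by (intro nn_integral_indicator) auto
    finally show "emeasure (M W u u) A = emeasure (density (M U u u) (indicator W)) A"
      using U'(4)[OF W A] by simp
  qed
  also have "density (M U u u) (indicator W) = density (M U u u) (\<lambda>x. ennreal (indicator W x))"
    by (simp add: ennreal_indicator)
  also have "integral\<^sup>L \<dots> \<phi> = integral\<^sup>L (M U u u) (\<lambda>x. indicator W x *\<^sub>R \<phi> x)"
    using \<phi>(1) Wm U'(1) by (intro integral_density) (auto simp: measurable_cong_sets[OF U'(1) refl])
  also have "\<dots> = integral\<^sup>L (M U u u) \<phi>"
    by (rule Bochner_Integration.integral_cong) (use \<phi>(2) in \<open>auto simp: indicator_def\<close>)
  finally show ?thesis .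
qed

lemma odet2_conv_continuous:
  assumes "Cc F" "Cc H"
  shows "continuous_on UNIV (\<lambda>x. odet2 (hmat (\<lambda>h k. conv F (ker2 c \<delta> h k) x)) (hmat (\<lambda>h k. conv H (ker2 c \<delta>
      h k) x)))"
proof -
  have *: "continuous_on UNIV (conv X (ker2 c \<delta> h k))" if "Cc X" for X h k
    by (intro conv_continuous that Cc_continuous ker_Cc)
  show ?thesis unfolding odet2_hmat by (intro continuous_intros * assms) auto
qed

text \<open>\<open>ennreal\<close> sends negative reals to 0, so the density can be replaced by the
  determinant itself only because plurisubharmonicity makes it nonnegative on
  \<open>U\<close>.\<close>

lemma mixed_MA_moll_integral:
  assumes MA: "is_mixed_MA M" and U: "open U" and F: "Cc F" and psh: "opsh_cont U (moll \<delta> F)"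
    and \<phi>: "Cc \<phi>" "\<And>x. x \<notin> U \<Longrightarrow> \<phi> x = 0"
  shows "integral\<^sup>L (M U (moll \<delta> F) (moll \<delta> F)) \<phi>
    = integral\<^sup>L lborel (\<lambda>x. odet2 (hmat (\<lambda>h k. conv F (ker2 (mnorm \<delta>) \<delta> h k) x)) (hmat (\<lambda>h k. conv F (ker2
        (mnorm \<delta>) \<delta> h k) x)) * \<phi> x)"
proof -
  define d where "d = (\<lambda>x. odet2 (hmat (\<lambda>h k. conv F (ker2 (mnorm \<delta>) \<delta> h k) x)) (hmat (\<lambda>h k. conv F (ker2
      (mnorm \<delta>) \<delta> h k) x)))"
  have [measurable]: "d \<in> borel_measurable borel"
    unfolding d_def by (intro borel_measurable_continuous_onI odet2_conv_continuous F)
  have [measurable]: "\<phi> \<in> borel_measurable borel" using \<phi>(1)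
      by (intro borel_measurable_continuous_onI Cc_continuous)
  have [measurable]: "U \<in> sets borel" using U by simp
  have nn: "0 \<le> d x" if "x \<in> U" for x
    using odet2_conv_ker_nonneg[OF F U that psh] unfolding hessO_conv_ker[OF F] d_def .
  have "M U (moll \<delta> F) (moll \<delta> F) = density lborel (\<lambda>x. ennreal (indicator U x * d x))"
    using mixed_MA_properties(3)[OF MA U psh psh C2_on_conv_ker[OF F] C2_on_conv_ker[OF F]]
        unfolding hessO_conv_ker[OF F] d_def .
  then have "integral\<^sup>L (M U (moll \<delta> F) (moll \<delta> F)) \<phi> = integral\<^sup>L lborel (\<lambda>x. (indicator U x * d x) *\<^sub>R \<phi> x)"
    by (simp only:) (rule integral_density, auto simp: indicator_def nn)
  also have "\<dots> = integral\<^sup>L lborel (\<lambda>x. d x * \<phi> x)"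
    by (rule Bochner_Integration.integral_cong) (use \<phi>(2) in \<open>auto simp: indicator_def\<close>)
  finally show ?thesis by (simp add: d_def)
qed

text \<open>Both integrals are limits of sequences that agree term by term. The mollifications of
  \<open>w\<close> and \<open>u\<close> lead to a mixed determinant that lives within the
  mollification radius of \<open>K\<close>; there \<open>\<phi>\<close> is 1, so it drops out and
  the integral is 0.\<close>

lemma mixed_MA_integral_eq:
  fixes \<phi> :: "pt \<Rightarrow> real"
  assumes MA: "is_mixed_MA M" and G: "open G" and u: "opsh_cont G u" and w: "opsh_cont G w"
    and K: "compact K" "K \<subseteq> G" and eq: "\<And>x. x \<in> G \<Longrightarrow> x \<notin> K \<Longrightarrow> w x = u x"
    and \<phi>: "continuous_on UNIV \<phi>" "compact (closure {x. \<phi> x \<noteq> 0})" "closure {x. \<phi> x \<noteq> 0} \<subseteq> G"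
    and e0: "e0 > 0" "\<And>x y. x \<in> K \<Longrightarrow> dist x y \<le> e0 \<Longrightarrow> \<phi> y = 1"
  shows "integral\<^sup>L (M G w w) \<phi> = integral\<^sup>L (M G u u) \<phi>"
proof -
  define C where "C = closure {x. \<phi> x \<noteq> 0}"
  have cC: "compact C" and subC: "C \<subseteq> G" unfolding C_def by (rule \<phi>)+
  have Csub: "x \<in> C" if "\<phi> x \<noteq> 0" for x using that closure_subset[of "{x. \<phi> x \<noteq> 0}"] by (auto simp: C_def)
  obtain \<theta> e where \<theta>: "e > 0" "continuous_on UNIV \<theta>" "\<And>c x. c \<in> C \<Longrightarrow> dist c x \<le> e \<Longrightarrow> \<theta> x = (1::real)"
      "compact (closure {x. \<theta> x \<noteq> 0})" "closure {x. \<theta> x \<noteq> 0} \<subseteq> G"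
    by (rule cutoff_exists[OF cC G subC]) blast
  have \<theta>G: "x \<in> G" if "\<theta> x \<noteq> 0" for x using that \<theta>(5) closure_subset[of "{x. \<theta> x \<noteq> 0}"] by auto
  \<comment> \<open>Half of the margin \<open>e\<close> goes into this neighbourhood of the support
    of \<open>\<phi>\<close>, the other half bounds the mollification radius. Mollifying at points
    of \<open>U\<close> thus sees only the region where \<open>\<theta>\<close> is 1.\<close>
  define U where "U = (\<Union>c\<in>C. ball c (e/2))"
  have U: "open U" "C \<subseteq> U" "U \<subseteq> G"
  proof -
    show "open U" "C \<subseteq> U" using \<theta>(1) by (auto simp: U_def)
    show "U \<subseteq> G"
    proof
      fix x assume "x \<in> U"
      then obtain c where "c \<in> C" "dist c x \<le> e" using \<theta>(1) by (auto simp: U_def)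
      then show "x \<in> G" using \<theta>(3)[of c x] \<theta>G[of x] by simp
    qed
  qed
  define ext where "ext = (\<lambda>f x. if x \<in> G then \<theta> x * f x else (0::real))"
  have ext_Cc: "Cc (ext f)" if "opsh_cont G f" for f
    unfolding ext_def using that by (intro cutoff_mult_Cc G \<theta>) (auto simp: opsh_cont_def)
  have thick: "x - y \<in> G \<and> ext f (x - y) = f (x - y)" if "x \<in> U" "norm y \<le> e / 2" for x y f
  proof -
    from that(1) obtain c where c: "c \<in> C" "dist c x < e / 2" unfolding U_def mem_ball[symmetric] by blast
    have "dist c (x - y) \<le> dist c x + norm y" using dist_triangle[of c "x - y" x] by (simp add: dist_norm)
    then have "\<theta> (x - y) = 1" using \<theta>(3)[OF c(1), of "x - y"] c that(2) by linarith
    then show ?thesis using \<theta>G[of "x - y"] by (simp add: ext_def)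
  qed
  \<comment> \<open>The bound \<open>e / 2\<close> makes the mollifications plurisubharmonic on
    \<open>U\<close>; the bound \<open>e0\<close> keeps what is smeared out of \<open>K\<close>
    inside the region where \<open>\<phi>\<close> is 1.\<close>
  define \<delta> where "\<delta> = (\<lambda>n. min (e / 2) e0 * inverse (real (Suc n)))"
  have \<delta>: "\<delta> n > 0" "\<delta> n \<le> e / 2" "\<delta> n \<le> e0" for n
  proof -
    have pos: "min (e / 2) e0 > 0" using \<theta>(1) e0(1) by simp
    then show "\<delta> n > 0" unfolding \<delta>_def by (intro mult_pos_pos) auto
    have "inverse (real (Suc n)) \<le> 1" by (simp add: field_simps)
    then have "\<delta> n \<le> min (e / 2) e0 * 1" unfolding \<delta>_def using pos by (intro mult_left_mono) auto
    then show "\<delta> n \<le> e / 2" "\<delta> n \<le> e0" by linarith+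
  qed
  have \<delta>0: "\<delta> \<longlonglongrightarrow> 0"
    using tendsto_mult_left[OF LIMSEQ_inverse_real_of_nat, of "min (e / 2) e0"]
        unfolding \<delta>_def mult_zero_right .
  have psh: "opsh_cont U (moll (\<delta> n) (ext f))" if "opsh_cont G f" for f n
  proof (rule opsh_moll[OF ext_Cc[OF that] \<delta>(1) that])
    fix x y :: pt assume "x \<in> U" "norm y \<le> \<delta> n"
    then show "x - y \<in> G \<and> ext f (x - y) = f (x - y)" using \<delta>(2)[of n] by (intro thick) auto
  qed
  have lim: "(\<lambda>n. integral\<^sup>L (M U (moll (\<delta> n) (ext f)) (moll (\<delta> n) (ext f))) \<phi>) \<longlonglongrightarrow> integral\<^sup>L (M G f f) \<phi>"
    if f: "opsh_cont G f" for f
  proof -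
    have loc: "locally_uniform_conv U (\<lambda>n. moll (\<delta> n) (ext f)) f"
      unfolding locally_uniform_conv_def uniform_limit_iff
    proof (intro allI impI)
      fix K \<epsilon> assume K: "compact K \<and> K \<subseteq> U" and \<epsilon>: "\<epsilon> > (0::real)"
      obtain d where d: "d > 0" "\<And>\<delta> x. 0 < \<delta> \<Longrightarrow> \<delta> < d \<Longrightarrow> \<bar>moll \<delta> (ext f) x - ext f x\<bar> \<le> \<epsilon> / 2"
        using moll_approx[OF ext_Cc[OF f], of "\<epsilon> / 2"] \<epsilon> by auto
      have "eventually (\<lambda>n. \<delta> n < d) sequentially" using order_tendstoD(2)[OF \<delta>0 d(1)] .
      then show "eventually (\<lambda>n. \<forall>x\<in>K. dist (moll (\<delta> n) (ext f) x) (f x) < \<epsilon>) sequentially"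
      proof eventually_elim
        case (elim n)
        show ?case
        proof
          fix x assume "x \<in> K"
          then have "ext f x = f x" using thick[of x 0 f] K \<theta>(1) by auto
          then show "dist (moll (\<delta> n) (ext f) x) (f x) < \<epsilon>"
            using d(2)[OF \<delta>(1) elim, of x] \<epsilon> by (simp add: dist_real_def)
        qed
      qed
    qed
    have "(\<lambda>n. integral\<^sup>L (M U (moll (\<delta> n) (ext f)) (moll (\<delta> n) (ext f))) \<phi>) \<longlonglongrightarrow> integral\<^sup>L (M U f f) \<phi>"
    proof (rule mixed_MA_weak_conv[OF MA U(1) opsh_cont_subset[OF f U(3)] _ loc])
      show "opsh_cont U (moll (\<delta> n) (ext f))" for n by (rule psh[OF f])
      show "continuous_on UNIV \<phi>" "compact (closure {x. \<phi> x \<noteq> 0})" by (rule \<phi>)+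
      show "closure {x. \<phi> x \<noteq> 0} \<subseteq> U" using U(2) unfolding C_def .
    qed
    also have "integral\<^sup>L (M U f f) \<phi> = integral\<^sup>L (M G f f) \<phi>"
      using Csub U(2) by (intro mixed_MA_integral_localize[OF MA G f U(1) U(3)]
          borel_measurable_continuous_onI \<phi>(1)) auto
    finally show ?thesis .
  qed
  have "integral\<^sup>L (M U (moll (\<delta> n) (ext w)) (moll (\<delta> n) (ext w))) \<phi>
      = integral\<^sup>L (M U (moll (\<delta> n) (ext u)) (moll (\<delta> n) (ext u))) \<phi>" for n
  proof -
    define H where "H = (\<lambda>F x. hmat (\<lambda>h k. conv F (ker2 (mnorm (\<delta> n)) (\<delta> n) h k) x))"
    define d where "d = (\<lambda>F x. odet2 (H F x) (H F x))"
    have cont: "continuous_on UNIV (ker2 (mnorm (\<delta> n)) (\<delta> n) h k)" for h k by (intro Cc_continuous ker_Cc)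
    have ccphi: "Cc \<phi>" by (rule Cc_compact_support[OF \<phi>(1,2)])
    have val: "integral\<^sup>L (M U (moll (\<delta> n) (ext f)) (moll (\<delta> n) (ext f))) \<phi>
        = integral\<^sup>L lborel (\<lambda>x. d (ext f) x * \<phi> x)"
      if f: "opsh_cont G f" for f
      unfolding d_def H_def using Csub U(2) by (intro mixed_MA_moll_integral MA U(1) ext_Cc[OF f] psh[OF f]
          ccphi) auto
    have int: "integrable lborel (\<lambda>x. d (ext f) x * \<phi> x)" if f: "opsh_cont G f" for f
      unfolding d_def H_def by (intro Cc_integrable Cc_mult_left ccphi odet2_conv_continuous ext_Cc[OF f])
    define fm fp where "fm = (\<lambda>x. ext w x - ext u x)" and "fp = (\<lambda>x. ext w x + ext u x)"
    have ccf: "Cc fm" "Cc fp" unfolding fm_def fp_def by (intro Cc_diff Cc_add ext_Cc u w)+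
    have diff: "d (ext w) x - d (ext u) x = odet2 (H fm x) (H fp x)" for x
      unfolding d_def H_def fm_def fp_def conv_diff[OF ext_Cc[OF w] ext_Cc[OF u] cont] conv_add[OF ext_Cc[OF
          w] ext_Cc[OF u] cont]
      by (rule odet2_square_diff) (simp_all add: ker2_sym)
    \<comment> \<open>A point where \<open>\<phi>\<close> is not 1 is farther than \<open>e0\<close>
      from \<open>K\<close>, off which \<open>fm\<close> vanishes. The kernel, of radius at most
      \<open>e0\<close>, meets only zeros of \<open>fm\<close>, so the Hessian of its mollification
      is 0 there.\<close>
    have supp: "odet2 (H fm x) (H fp x) * \<phi> x = odet2 (H fm x) (H fp x)" for x
    proof (cases "\<phi> x = 1")
      case False
      have "conv fm (ker2 (mnorm (\<delta> n)) (\<delta> n) h k) x = 0" for h k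
      proof (rule conv_zero)
        fix y assume "fm y \<noteq> 0"
        then have "y \<in> G" "w y \<noteq> u y" by (auto simp: fm_def ext_def split: if_splits)
        then have "y \<in> K" using eq by blast
        then have "dist y x > e0" using e0(2)[of y x] False by force
        then have "norm (x - y) \<ge> \<bar>\<delta> n\<bar>" using \<delta>(1,3)[of n] by (simp add: dist_norm norm_minus_commute)
        then show "ker2 (mnorm (\<delta> n)) (\<delta> n) h k (x - y) = 0" by (rule ker_zero(3))
      qed
      then show ?thesis unfolding H_def by (simp add: odet2_hmat)
    qed simp
    have "integral\<^sup>L lborel (\<lambda>x. d (ext w) x * \<phi> x) - integral\<^sup>L lborel (\<lambda>x. d (ext u) x * \<phi> x)
      = integral\<^sup>L lborel (\<lambda>x. d (ext w) x * \<phi> x - d (ext u) x * \<phi> x)"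
      using int[OF u] int[OF w] by simp
    also have "\<dots> = integral\<^sup>L lborel (\<lambda>x. odet2 (H fm x) (H fp x))"
      by (simp only: left_diff_distrib[symmetric] diff supp)
    also have "\<dots> = 0" unfolding H_def by (rule integral_odet2_conv_zero[OF ccf])
    finally show ?thesis by (simp add: val u w)
  qed
  then show ?thesis using LIMSEQ_unique[OF lim[OF w]] lim[OF u] by simp
qed

text \<open>Hypothesis \<open>cpt\<close> is what relative compactness becomes once the surrounding
  domain is discarded: \<open>v - u\<close> tends to 0 on leaving the compact subsets of
  \<open>G\<close>.\<close>

lemma mixed_MA_comparison:
  assumes MA: "is_mixed_MA M" and G: "open G" and u: "opsh_cont G u" and v: "opsh_cont G v"
    and lt: "\<And>x. x \<in> G \<Longrightarrow> u x < v x"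
    and cpt: "\<And>e. e > 0 \<Longrightarrow> compact {x\<in>G. u x \<le> v x - e}"
  shows "emeasure (M G v v) G \<le> emeasure (M G u u) G"
proof -
  define w where "w = (\<lambda>n x. max (u x) (v x - 1 / (real n + 1)))"
  have w: "opsh_cont G (w n)" for n unfolding w_def by (intro opsh_cont_max opsh_cont_diff_const u v)
  have Gm: "G \<in> sets borel" using G by simp
  have lim: "locally_uniform_conv G w v"
    unfolding locally_uniform_conv_def uniform_limit_iff
  proof (intro allI impI)
    fix K \<epsilon> assume K: "compact K \<and> K \<subseteq> G" and \<epsilon>: "\<epsilon> > (0::real)"
    have "(\<lambda>n. 1 / (real n + 1)) \<longlonglongrightarrow> 0"
      using LIMSEQ_inverse_real_of_nat by (simp add: inverse_eq_divide add.commute)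
    then have "eventually (\<lambda>n. 1 / (real n + 1) < \<epsilon>) sequentially" using order_tendstoD(2) \<epsilon> by blast
    then show "eventually (\<lambda>n. \<forall>x\<in>K. dist (w n x) (v x) < \<epsilon>) sequentially"
    proof eventually_elim
      case (elim n)
      have "0 < 1 / (real n + 1)" by simp
      show ?case
      proof
        fix x assume "x \<in> K"
        then have "u x < v x" using lt K by blast
        then show "dist (w n x) (v x) < \<epsilon>"
          using elim \<open>0 < 1 / (real n + 1)\<close> unfolding w_def dist_real_def by linarith
      qed
    qed
  qed
  have sets: "sets (M G f f) = sets borel" if "opsh_cont G f" for f
    using mixed_MA_properties(1)[OF MA G that that] by simp
  have integrable: "integrable (M G f f) \<psi>"
    if f: "opsh_cont G f" and \<psi>: "continuous_on UNIV \<psi>" "\<And>x. 0 \<le> \<psi> x" "\<And>x. \<psi> x \<le> 1"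
      "compact (closure {x. \<psi> x \<noteq> 0})" "closure {x. \<psi> x \<noteq> 0} \<subseteq> G" for f and \<psi> :: "pt \<Rightarrow> real"
  proof (rule integrableI_bounded_set[where A = "closure {x. \<psi> x \<noteq> 0}" and B = 1])
    show "closure {x. \<psi> x \<noteq> 0} \<in> sets (M G f f)" using sets[OF f] by simp
    show "\<psi> \<in> borel_measurable (M G f f)"
      using borel_measurable_continuous_onI[OF \<psi>(1)] measurable_cong_sets[OF sets[OF f] refl] by blast
    show "emeasure (M G f f) (closure {x. \<psi> x \<noteq> 0}) < \<infinity>" by (rule mixed_MA_properties(2)[OF MA G f f \<psi>(4,5)])
    show "AE x in M G f f. x \<in> closure {x. \<psi> x \<noteq> 0} \<longrightarrow> norm (\<psi> x) \<le> 1" using \<psi>(2,3) by simp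
    show "AE x in M G f f. x \<notin> closure {x. \<psi> x \<noteq> 0} \<longrightarrow> \<psi> x = 0" using closure_subset[of "{x. \<psi> x \<noteq> 0}"] by auto
  qed
  \<comment> \<open>Weak convergence sees only functions of compact support in \<open>G\<close>, and
    finiteness of the measures is given only on compact sets; hence compact subsets come
    first.\<close>
  have K: "emeasure (M G v v) K \<le> emeasure (M G u u) G" if K: "compact K" "K \<subseteq> G" for K
  proof -
    obtain \<psi> :: "pt \<Rightarrow> real" and d where \<psi>: "d > 0" "continuous_on UNIV \<psi>" "\<And>x. 0 \<le> \<psi> x" "\<And>x. \<psi> x \<le> 1"
      "\<And>c x. c \<in> K \<Longrightarrow> dist c x \<le> d \<Longrightarrow> \<psi> x = 1" "compact (closure {x. \<psi> x \<noteq> 0})" "closure {x. \<psi> x \<noteq> 0} \<subseteq> G"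
      by (rule cutoff_exists[OF K(1) G K(2)]) blast
    have "emeasure (M G v v) K = (\<integral>\<^sup>+x. indicator K x \<partial>M G v v)"
      using sets[OF v] compact_imp_closed[OF K(1)] by simp
    also have "\<dots> \<le> (\<integral>\<^sup>+x. ennreal (\<psi> x) \<partial>M G v v)"
      using \<psi>(1,3) \<psi>(5)[OF _ order.trans[OF eq_refl[OF dist_self]]]
      by (intro nn_integral_mono) (auto simp: indicator_def)
    also have "\<dots> = ennreal (integral\<^sup>L (M G v v) \<psi>)"
      using \<psi> by (intro nn_integral_eq_integral integrable v) auto
    also have "\<dots> \<le> emeasure (M G u u) G"
    proof (rule LIMSEQ_le_const2)
      show "(\<lambda>n. ennreal (integral\<^sup>L (M G (w n) (w n)) \<psi>)) \<longlonglongrightarrow> ennreal (integral\<^sup>L (M G v v) \<psi>)"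
        by (intro tendsto_ennrealI mixed_MA_weak_conv MA G v w lim \<psi>)
      have "ennreal (integral\<^sup>L (M G (w n) (w n)) \<psi>) \<le> emeasure (M G u u) G" for n
      proof -
        define Kn where "Kn = {x\<in>G. u x \<le> v x - 1 / (real n + 1)}"
        have Kn: "compact Kn" "Kn \<subseteq> G" using cpt[of "1 / (real n + 1)"] by (auto simp: Kn_def)
        have cpt': "compact (Kn \<union> closure {x. \<psi> x \<noteq> 0})" and sub: "Kn \<union> closure {x. \<psi> x \<noteq> 0} \<subseteq> G"
          using Kn \<psi>(6,7) by (auto intro: compact_Un)
        \<comment> \<open>A second cutoff, depending on \<open>n\<close>: \<open>\<psi>\<close> has
          to stay fixed in the limit, while \<open>Kn\<close> grows with \<open>n\<close>. That
          \<open>\<phi>\<close> is 1 on the support of \<open>\<psi>\<close> gives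
          \<open>\<psi> \<le> \<phi>\<close>; that it is 1 near \<open>Kn\<close> lets
          \<open>u\<close> replace \<open>w n\<close>.\<close>
        obtain \<phi> :: "pt \<Rightarrow> real" and e where \<phi>: "e > 0" "continuous_on UNIV \<phi>" "\<And>x. 0 \<le> \<phi> x" "\<And>x. \<phi> x \<le> 1"
          "\<And>c x. c \<in> Kn \<union> closure {x. \<psi> x \<noteq> 0} \<Longrightarrow> dist c x \<le> e \<Longrightarrow> \<phi> x = 1" "compact (closure {x. \<phi> x \<noteq> 0})"
          "closure {x. \<phi> x \<noteq> 0} \<subseteq> G"
          by (rule cutoff_exists[OF cpt' G sub]) blast
        have le: "\<psi> x \<le> \<phi> x" for x
        proof (cases "\<psi> x = 0")
          case False
          then have "x \<in> closure {x. \<psi> x \<noteq> 0}" using closure_subset[of "{x. \<psi> x \<noteq> 0}"] by auto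
          then have "\<phi> x = 1" using \<phi>(1) by (intro \<phi>(5)[of x]) auto
          then show ?thesis using \<psi>(4) by simp
        qed (simp add: \<phi>(3))
        have "integral\<^sup>L (M G (w n) (w n)) \<psi> \<le> integral\<^sup>L (M G (w n) (w n)) \<phi>"
          by (intro integral_mono integrable w \<psi> \<phi> le)
        also have "\<dots> = integral\<^sup>L (M G u u) \<phi>"
        proof (rule mixed_MA_integral_eq[OF MA G u w Kn _ \<phi>(2,6,7) \<phi>(1)])
          show "w n x = u x" if "x \<in> G" "x \<notin> Kn" for x using that by (simp add: Kn_def w_def)
          show "\<phi> y = 1" if "x \<in> Kn" "dist x y \<le> e" for x y using \<phi>(5) that by blast
        qed
        finally have "ennreal (integral\<^sup>L (M G (w n) (w n)) \<psi>) \<le> ennreal (integral\<^sup>L (M G u u) \<phi>)"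
          by (rule ennreal_leI)
        also have "\<dots> = (\<integral>\<^sup>+x. ennreal (\<phi> x) \<partial>M G u u)"
          using \<phi> by (intro nn_integral_eq_integral[symmetric] integrable u) auto
        also have "\<dots> \<le> (\<integral>\<^sup>+x. indicator G x \<partial>M G u u)"
        proof (rule nn_integral_mono)
          fix x
          have "\<phi> x = 0" if "x \<notin> G" using that \<phi>(7) closure_subset[of "{x. \<phi> x \<noteq> 0}"] by auto
          then show "ennreal (\<phi> x) \<le> indicator G x" using \<phi>(4)[of x] by (auto simp: indicator_def)
        qed
        also have "\<dots> = emeasure (M G u u) G" using sets[OF u] Gm by simp
        finally show ?thesis .
      qed
      then show "\<exists>N. \<forall>n\<ge>N. ennreal (integral\<^sup>L (M G (w n) (w n)) \<psi>) \<le> emeasure (M G u u) G" by blast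
    qed
    finally show ?thesis .
  qed
  \<comment> \<open>Continuity from below along a compact exhaustion passes from compact subsets to
    \<open>G\<close>.\<close>
  obtain C where C: "\<And>n. compact (C n)" "\<And>n. C n \<subseteq> G" "\<And>n. C n \<subseteq> interior (C (Suc n))" "\<Union>(range C) = G"
    using open_Union_compact_subsets[OF G] by metis
  have "incseq C" using C(3) interior_subset by (intro incseq_SucI) blast
  moreover have "range C \<subseteq> sets (M G v v)" using borel_closed[OF compact_imp_closed[OF C(1)]] sets[OF v] by auto
  ultimately have "emeasure (M G v v) G = (SUP n. emeasure (M G v v) (C n))"
    using SUP_emeasure_incseq C(4) by metis
  also have "\<dots> \<le> emeasure (M G u u) G" using C by (intro SUP_least K) auto
  finally show ?thesis .
qed

theorem theorem1p1:
  fixes \<Omega> :: "pt set" and u v :: "pt \<Rightarrow> real"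
    and M :: "pt set \<Rightarrow> (pt \<Rightarrow> real) \<Rightarrow> (pt \<Rightarrow> real) \<Rightarrow> pt measure"
  assumes MA: "is_mixed_MA M"
    and dom: "open \<Omega>" "connected \<Omega>" "\<Omega> \<noteq> {}" "bounded \<Omega>"
    and u: "opsh_cont \<Omega> u" and v: "opsh_cont \<Omega> v"
    and relcpt: "compact (closure {x\<in>\<Omega>. u x < v x})" "closure {x\<in>\<Omega>. u x < v x} \<subseteq> \<Omega>"
  shows "emeasure (M \<Omega> u u) {x\<in>\<Omega>. u x < v x} \<ge> emeasure (M \<Omega> v v) {x\<in>\<Omega>. u x < v x}"
proof -
  define G where "G = {x\<in>\<Omega>. u x < v x}"
  have cont: "continuous_on \<Omega> (\<lambda>x. u x - v x)"
    using u v by (intro continuous_on_diff) (simp_all add: opsh_cont_def)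
  have sub: "G \<subseteq> \<Omega>" by (auto simp: G_def)
  have G: "open G"
  proof -
    have "G = \<Omega> \<inter> (\<lambda>x. u x - v x) -` {..<0}" by (auto simp: G_def)
    then show ?thesis using continuous_open_preimage[OF cont dom(1), of "{..<0}"] by simp
  qed
  have "emeasure (M G v v) G \<le> emeasure (M G u u) G"
  proof (rule mixed_MA_comparison[OF MA G opsh_cont_subset[OF u sub] opsh_cont_subset[OF v sub]])
    show "u x < v x" if "x \<in> G" for x using that by (simp add: G_def)
    \<comment> \<open>Relative compactness puts the closure of \<open>G\<close> inside
      \<open>\<Omega>\<close>, so \<open>u - v\<close> is continuous on it. A point of the closure
      where \<open>u - v\<close> is at most \<open>- e\<close> lies in \<open>G\<close> itself, so
      the set is closed in a compact set.\<close>
    show "compact {x\<in>G. u x \<le> v x - e}" if e: "e > 0" for e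
    proof -
      have "closed (closure G \<inter> (\<lambda>x. u x - v x) -` {..-e})"
        using relcpt by (intro continuous_closed_preimage continuous_on_subset[OF cont]) (auto simp: G_def)
      from closed_Int_compact[OF this relcpt(1)]
      have "compact (closure G \<inter> (\<lambda>x. u x - v x) -` {..-e})" by (simp add: G_def Int_commute Int_left_commute)
      also have "closure G \<inter> (\<lambda>x. u x - v x) -` {..-e} = {x\<in>G. u x \<le> v x - e}"
        using relcpt(2) e closure_subset[of G] by (force simp: G_def)
      finally show ?thesis .
    qed
  qed
  moreover have "emeasure (M G f f) G = emeasure (M \<Omega> f f) G" if "opsh_cont \<Omega> f" for f
    using mixed_MA_properties(4)[OF MA dom(1) that that G sub, of G] G by simp
  ultimately show ?thesis using u v by (simp add: G_def)
qed

end
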